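(* Let $\alpha\in[0,1)$ and let $G$ be a graph of order $n$ with $\mathrm{diam}(G)\ge k$. If $k=1$, then $\rho_\alpha(G)=\rho_\alpha(K_n)$. If $k\ge 2$, then \[ \rho_\alpha(G)\le \rho_\alpha\bigl(B_{n-k+2,\lfloor k/2\rfloor,\lceil k/2\rceil}\bigr), \] with equality if and only if $G=B_{n-k+2,\lfloor k/2\rfloor,\lceil k/2\rceil}$.
   Context: For a graph $G$ with adjacency matrix $A(G)$ and diagonal matrix of vertex degrees $D(G)$, and for $\alpha\in[0,1]$, let $A_\alpha(G)=\alpha D(G)+(1-\alpha)A(G)$, and let $\rho_\alpha(G)$ denote the spectral radius of $A_\alpha(G)$. $\mathrm{diam}(G)$ is the diameter of $G$. $K_n$ is the complete graph of order $n$ and $P_m$ is the path of order $m$. $B_{p,q,r}$ is the graph obtained from the complete graph $K_p$ by deleting an edge and attaching the paths $P_q$ and $P_r$ to its ends, one path to each end of the deleted edge; attaching a path $P_m$ to a vertex $u$ means identifying an end-vertex of $P_m$ with $u$, so that $m-1$ new vertices are added and $B_{p,q,r}$ has order $p+q+r-2$. Equality of graphs means isomorphism.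
   Formalization: G is taken connected (false for infinite diameter: K_4 plus an isolated vertex, k=3, α=0). For k=1 the printed equality is false for P_3; proved instead: equality if diam(G)=1, and for diam(G)≥1, ρ_α(G)≤ρ_α(K_n) with equality iff G=K_n. *)

theory Defs
  imports
    "Graph_Theory.Graph_Theory"
    "Jordan_Normal_Form.Spectral_Radius"
begin

text \<open>
  A finite simple graph is a \<^locale>\<open>pair_graph\<close>: an edge between \<open>u\<close> and \<open>v\<close> is the pair of arcs
  \<open>(u, v)\<close> and \<open>(v, u)\<close>, so the out-degree of a vertex is its degree.
\<close>

text \<open>
  Rows and columns are indexed by \<open>0, \<dots>, n - 1\<close> through an arbitrary enumeration of the
  vertices. Another enumeration yields a permutation-similar matrix, so the spectrum does not
  depend on the choice.
\<close>

definition vert_enum :: "'a pair_pre_digraph \<Rightarrow> nat \<Rightarrow> 'a" where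
  "vert_enum G = (SOME f. bij_betw f {..<card (pverts G)} (pverts G))"

definition adjacency_mat :: "'a pair_pre_digraph \<Rightarrow> real mat" where
  "adjacency_mat G = mat (card (pverts G)) (card (pverts G))
     (\<lambda>(i, j). if (vert_enum G i, vert_enum G j) \<in> parcs G then 1 else 0)"

definition degree_mat :: "'a pair_pre_digraph \<Rightarrow> real mat" where
  "degree_mat G = mat (card (pverts G)) (card (pverts G))
     (\<lambda>(i, j). if i = j then real (out_degree (with_proj G) (vert_enum G i)) else 0)"

definition alpha_mat :: "real \<Rightarrow> 'a pair_pre_digraph \<Rightarrow> real mat" where
  "alpha_mat \<alpha> G = \<alpha> \<cdot>\<^sub>m degree_mat G + (1 - \<alpha>) \<cdot>\<^sub>m adjacency_mat G"

definition rho_alpha :: "real \<Rightarrow> 'a pair_pre_digraph \<Rightarrow> real" where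
  "rho_alpha \<alpha> G = spectral_radius (map_mat complex_of_real (alpha_mat \<alpha> G))"

text \<open>
  The distance is the infimum of the lengths of walks, \<open>\<infinity>\<close> if there is none; hence the diameter
  of a disconnected graph is \<open>\<infinity>\<close>.
\<close>

definition graph_dist :: "'a pair_pre_digraph \<Rightarrow> 'a \<Rightarrow> 'a \<Rightarrow> ereal" where
  "graph_dist G u v = wf_digraph.\<mu> (with_proj G) (\<lambda>_. 1) u v"

definition diam :: "'a pair_pre_digraph \<Rightarrow> ereal" where
  "diam G = (SUP u\<in>pverts G. SUP v\<in>pverts G. graph_dist G u v)"

definition complete_graph :: "nat \<Rightarrow> nat pair_pre_digraph" where
  "complete_graph n = \<lparr> pverts = {..<n}, parcs = {(u, v). u < n \<and> v < n \<and> u \<noteq> v} \<rparr>"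

definition delete_edge :: "'a pair_pre_digraph \<Rightarrow> 'a \<Rightarrow> 'a \<Rightarrow> 'a pair_pre_digraph" where
  "delete_edge G u v = G\<lparr> parcs := parcs G - {(u, v), (v, u)} \<rparr>"

text \<open>
  For \<open>G\<close> with vertex set \<open>{..<N}\<close>, attaching \<open>P\<^sub>m\<close> at \<open>u\<close> adds the path
  \<open>u, N, N + 1, \<dots>, N + m - 2\<close>.
\<close>

definition attach_path :: "nat pair_pre_digraph \<Rightarrow> nat \<Rightarrow> nat \<Rightarrow> nat pair_pre_digraph" where
  "attach_path G u m =
     (let N = card (pverts G); w = (\<lambda>i. if i = 0 then u else N + i - 1)
      in \<lparr> pverts = pverts G \<union> {N..<N + m - 1},
           parcs = parcs G \<union> {(x, y). \<exists>i. Suc i < m \<and> {x, y} = {w i, w (Suc i)}} \<rparr>)"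

definition B_graph :: "nat \<Rightarrow> nat \<Rightarrow> nat \<Rightarrow> nat pair_pre_digraph" where
  "B_graph p q r = attach_path (attach_path (delete_edge (complete_graph p) 0 1) 0 q) 1 r"

lemma complete_digraph_complete_graph: "complete_digraph n (with_proj (complete_graph n))"
proof -
  have "finite {(u, v). u < n \<and> v < n \<and> u \<noteq> v}"
    by (rule finite_subset[of _ "{..<n} \<times> {..<n}"]) auto
  then have "pair_graph (complete_graph n)"
    by unfold_locales (auto simp: complete_graph_def symmetric_def intro: symI)
  then have "graph (with_proj (complete_graph n))"
    by (rule pair_graph.pair_graphD_graph)
  then show ?thesis
    by (simp add: complete_digraph_def) (auto simp: complete_graph_def)
qed

lemma pverts_attach_path:
  assumes "pverts G = {..<N}" "0 < m"
  shows "pverts (attach_path G u m) = {..<N + m - 1}"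
proof -
  have "{..<N} \<union> {N..<N + m - 1} = {..<N + m - 1}"
    using assms(2) by (intro ivl_disj_un_one(2)) linarith
  then show ?thesis
    by (simp add: attach_path_def Let_def assms(1))
qed

lemma pverts_B_graph:
  assumes "2 \<le> p" "0 < q" "0 < r"
  shows "pverts (B_graph p q r) = {..<p + q + r - 2}"
proof -
  have "pverts (delete_edge (complete_graph p) 0 1) = {..<p}"
    by (simp add: delete_edge_def complete_graph_def)
  then have "pverts (attach_path (delete_edge (complete_graph p) 0 1) 0 q) = {..<p + q - 1}"
    by (rule pverts_attach_path) (rule assms)
  then have "pverts (B_graph p q r) = {..<(p + q - 1) + r - 1}"
    unfolding B_graph_def by (rule pverts_attach_path) (rule assms)
  moreover have "(p + q - 1) + r - 1 = p + q + r - 2"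
    using assms by linarith
  ultimately show ?thesis
    by (simp only:)
qed

end

theory Submission
  imports Defs "HOL-Analysis.Function_Topology"
begin

text \<open>
  Take a positive unit vector \<open>x\<close> maximising the quadratic form of \<open>A\<^sub>\<alpha>(G)\<close> and a geodesic with
  \<open>k + 1\<close> vertices. Every vertex off the geodesic has at most three neighbours on it. Move the values
  of \<open>x\<close> on the geodesic to the path of the extremal graph, the largest in the centre and then
  alternately to both sides, and keep the other values. The part of the form coming from the path
  does not decrease, by a rearrangement inequality, and a vertex off the path now sees the three
  largest values, so the form does not decrease. In case of equality the rearranged vector is an
  eigenvector of the extremal graph; its eigenvalue equations separate the three largest path values
  from the others, so all outside vertices of \<open>G\<close> are joined to the same three consecutive vertices,
  and comparing the tails of the two eigenvectors shows that these lie in the middle of the geodesic.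
\<close>

section \<open>Rayleigh quotients of nonnegative symmetric kernels\<close>

text \<open>Values of \<open>x\<close> on the geodesic may be tied, so equality of the forms does
  not reveal their order along the path. The equality case therefore recovers only the set of
  positions of the three largest values: \<open>a 3 < a 2\<close> makes this set unambiguous, and it
  is the contact set of every outside vertex. Where it lies along the path is read off from the
  eigenvalue equations. That comparison is one-sided: it shows that the tail to the left of the set
  is not too short. Applied to the reversed geodesic it bounds the right tail, and as the two tails
  have a fixed total length, only the middle remains, up to reflection.

  The geodesic may be the initial piece of a longer one. All that is kept of its minimality is that
  path vertices joined by one arc, or by two arcs through any vertex, are at most one, respectively
  two, positions apart.

  With \<open>m\<close> vertices off the path, n = k + m + 1, and the clique order n - k + 2 is
  \<open>m + 3\<close>: the outside vertices and the three central path vertices. The deleted edge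
  is the one between the outer two of these three, which are not adjacent on a geodesic.\<close>

definition kernel_form :: "('v \<Rightarrow> 'v \<Rightarrow> real) \<Rightarrow> 'v set \<Rightarrow> ('v \<Rightarrow> real) \<Rightarrow> real" where
  "kernel_form K V x = (\<Sum>u\<in>V. \<Sum>v\<in>V. K u v * x u * x v)"

lemma kernel_form_cong:
  assumes "\<And>u. u \<in> V \<Longrightarrow> x u = y u"
  shows "kernel_form K V x = kernel_form K V y"
  unfolding kernel_form_def using assms by (intro sum.cong) auto

lemma kernel_form_scale: "kernel_form K V (\<lambda>u. c * x u) = c\<^sup>2 * kernel_form K V x"
  unfolding kernel_form_def sum_distrib_left
  by (intro sum.cong) (auto simp: power2_eq_square)

lemma kernel_form_row: "kernel_form K V x = (\<Sum>u\<in>V. x u * (\<Sum>v\<in>V. K u v * x v))"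
  unfolding kernel_form_def sum_distrib_left by (intro sum.cong) (auto simp: mult_ac)

lemma kernel_form_perturb:
  assumes "\<And>u v. K u v = K v u"
  shows "kernel_form K V (\<lambda>u. x u + t * z u) =
    kernel_form K V x + 2 * t * (\<Sum>u\<in>V. z u * (\<Sum>v\<in>V. K u v * x v)) + t\<^sup>2 * kernel_form K V z"
proof -
  have swap: "(\<Sum>u\<in>V. \<Sum>v\<in>V. K u v * x u * z v) = (\<Sum>u\<in>V. \<Sum>v\<in>V. K u v * z u * x v)"
    by (subst sum.swap) (auto intro!: sum.cong simp: assms mult_ac)
  have "kernel_form K V (\<lambda>u. x u + t * z u) = (\<Sum>u\<in>V. \<Sum>v\<in>V. K u v * x u * x v
     + t * (K u v * x u * z v) + t * (K u v * z u * x v) + t\<^sup>2 * (K u v * z u * z v))"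
    unfolding kernel_form_def
    by (intro sum.cong) (auto simp: algebra_simps power2_eq_square)
  also have "\<dots> = kernel_form K V x + t * (\<Sum>u\<in>V. \<Sum>v\<in>V. K u v * x u * z v)
     + t * (\<Sum>u\<in>V. \<Sum>v\<in>V. K u v * z u * x v) + t\<^sup>2 * kernel_form K V z"
    by (simp add: kernel_form_def sum.distrib sum_distrib_left)
  also have "\<dots> = kernel_form K V x + 2 * t * (\<Sum>u\<in>V. \<Sum>v\<in>V. K u v * z u * x v)
     + t\<^sup>2 * kernel_form K V z"
    by (simp add: swap)
  also have "(\<Sum>u\<in>V. \<Sum>v\<in>V. K u v * z u * x v) = (\<Sum>u\<in>V. z u * (\<Sum>v\<in>V. K u v * x v))"
    unfolding sum_distrib_left by (intro sum.cong) (auto simp: mult_ac)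
  finally show ?thesis .
qed

text \<open>The gap between the two sides of \<open>bound\<close> is nonnegative and vanishes at
  \<open>x\<close>. Moving from \<open>x\<close> by \<open>t\<close> times the residual
  \<open>g\<close> changes it by \<open>t\<^sup>2 * C - 2 * t * S\<close>, where \<open>S\<close> is
  the squared norm of \<open>g\<close>; for small positive \<open>t\<close> this is negative unless
  \<open>S = 0\<close>.\<close>

lemma rayleigh_equality_imp_eigenvector:
  assumes fin: "finite V" and sym: "\<And>u v. K u v = K v u"
    and bound: "\<And>z. kernel_form K V z \<le> M * (\<Sum>u\<in>V. (z u)\<^sup>2)"
    and eq: "kernel_form K V x = M * (\<Sum>u\<in>V. (x u)\<^sup>2)"
    and u: "u \<in> V"
  shows "(\<Sum>v\<in>V. K u v * x v) = M * x u"
proof -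
  define g where "g u = (\<Sum>v\<in>V. K u v * x v) - M * x u" for u
  define S where "S = (\<Sum>u\<in>V. (g u)\<^sup>2)"
  define C where "C = M * S - kernel_form K V g"
  have "2 * S \<le> t * C" if t: "t > 0" for t :: real
  proof -
    have sq: "(\<Sum>u\<in>V. (x u + t * g u)\<^sup>2) = (\<Sum>u\<in>V. (x u)\<^sup>2) + 2 * t * (\<Sum>u\<in>V. g u * x u) + t\<^sup>2 * S"
      by (simp add: S_def power2_sum sum.distrib sum_distrib_left power_mult_distrib mult_ac)
    have "kernel_form K V x + 2 * t * (\<Sum>u\<in>V. g u * (\<Sum>v\<in>V. K u v * x v)) + t\<^sup>2 * kernel_form K V g
       \<le> M * ((\<Sum>u\<in>V. (x u)\<^sup>2) + 2 * t * (\<Sum>u\<in>V. g u * x u) + t\<^sup>2 * S)"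
      using bound[of "\<lambda>u. x u + t * g u"] unfolding kernel_form_perturb[OF sym] sq .
    then have "2 * t * ((\<Sum>u\<in>V. g u * (\<Sum>v\<in>V. K u v * x v)) - M * (\<Sum>u\<in>V. g u * x u)) \<le> t\<^sup>2 * C"
      unfolding eq C_def by (simp add: algebra_simps)
    moreover have "(\<Sum>u\<in>V. g u * (\<Sum>v\<in>V. K u v * x v)) - M * (\<Sum>u\<in>V. g u * x u) = S"
    proof -
      define r where "r u = (\<Sum>v\<in>V. K u v * x v)" for u
      show ?thesis
        unfolding S_def power2_eq_square g_def r_def[symmetric]
        by (simp add: sum_distrib_left sum_subtractf algebra_simps sum.distrib)
    qed
    ultimately show ?thesis
      using t by (simp add: power2_eq_square mult_ac)
  qed
  note small = this
  have "S \<le> 0"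
  proof (rule ccontr)
    assume "\<not> S \<le> 0"
    then have S: "S > 0" by simp
    with small[of 1] have C: "C > 0" by simp
    \<comment> \<open>The choice \<open>t = S / C\<close> turns the inequality into
      \<open>2 * S \<le> S\<close>.\<close>
    have "2 * S \<le> (S / C) * C" using S C by (intro small) simp
    with C S show False by simp
  qed
  then have "S = 0" unfolding S_def using sum_nonneg[of V "\<lambda>u. (g u)\<^sup>2"] by force
  then have "(g u)\<^sup>2 = 0" unfolding S_def using fin u by (simp add: sum_nonneg_eq_0_iff)
  then show ?thesis by (simp add: g_def)
qed

text \<open>Vectors are functions on a type that may be infinite, so compactness is taken in the
  product topology: the cube is compact by Tychonoff, the sphere over \<open>V\<close> is closed,
  and the form is continuous because it involves finitely many coordinates. Passing to absolute
  values keeps the norm and, as \<open>K\<close> is nonnegative, does not lower the form.\<close>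

lemma rayleigh_maximum:
  assumes fin: "finite V" and ne: "V \<noteq> {}" and nonneg: "\<And>u v. K u v \<ge> (0::real)"
  shows "\<exists>x. (\<forall>u. x u \<ge> 0) \<and> (\<Sum>u\<in>V. (x u)\<^sup>2) = 1 \<and>
    (\<forall>z. kernel_form K V z \<le> kernel_form K V x * (\<Sum>u\<in>V. (z u)\<^sup>2))"
proof -
  define cube :: "('a \<Rightarrow> real) set" where "cube = PiE UNIV (\<lambda>u. {-1..1})"
  define sphere where "sphere = {x. (\<Sum>u\<in>V. (x u)\<^sup>2) = (1::real)}"
  have cont: "continuous_on UNIV (\<lambda>x. (\<Sum>u\<in>V. (x u)\<^sup>2) :: real)"
    by (intro continuous_intros continuous_on_product_coordinates)
  have contq: "continuous_on UNIV (kernel_form K V)"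
    unfolding kernel_form_def[abs_def]
    by (intro continuous_intros continuous_on_product_coordinates)
  have "compactin (product_topology (\<lambda>u::'a. euclideanreal) UNIV) cube"
    unfolding cube_def compactin_PiE by simp
  then have "compact cube"
    by (simp add: euclidean_product_topology)
  moreover have "closed sphere"
    unfolding sphere_def using cont
    by (intro closed_Collect_eq) (auto intro: continuous_intros)
  ultimately have comp: "compact (cube \<inter> sphere)" by (rule compact_Int_closed)
  obtain w where w: "w \<in> V" using ne by blast
  have "(\<lambda>u. if u = w then 1 else 0) \<in> cube \<inter> sphere"
    using fin w by (simp add: cube_def PiE_UNIV_domain sphere_def if_distrib[of "\<lambda>y. y\<^sup>2"] sum.delta cong: if_cong)
  then obtain x0 where x0: "x0 \<in> cube \<inter> sphere"
    and max: "\<And>z. z \<in> cube \<inter> sphere \<Longrightarrow> kernel_form K V z \<le> kernel_form K V x0"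
    using continuous_attains_sup[OF comp _ continuous_on_subset[OF contq]] by blast
  have unit: "kernel_form K V z \<le> kernel_form K V x0" if z: "(\<Sum>u\<in>V. (z u)\<^sup>2) = 1" for z
  proof -
    \<comment> \<open>A vector of norm one over \<open>V\<close> may be large elsewhere; cutting it
      to zero off \<open>V\<close> puts it into the cube and changes neither norm nor form.\<close>
    define z' where "z' u = (if u \<in> V then z u else 0)" for u
    have "\<bar>z u\<bar> \<le> 1" if "u \<in> V" for u
    proof -
      have "(z u)\<^sup>2 \<le> (\<Sum>u\<in>V. (z u)\<^sup>2)" using fin that by (intro member_le_sum) auto
      then show ?thesis using z abs_square_le_1[of "z u"] by simp
    qed
    then have "z' \<in> cube \<inter> sphere"
      using z by (auto simp: cube_def PiE_UNIV_domain sphere_def z'_def abs_le_iff minus_le_iff)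
    then show ?thesis using max[of z'] kernel_form_cong[of V z' z K] by (simp add: z'_def)
  qed
  define x where "x u = \<bar>x0 u\<bar>" for u
  define M where "M = kernel_form K V x0"
  have x1: "(\<Sum>u\<in>V. (x u)\<^sup>2) = 1" using x0 by (simp add: x_def sphere_def)
  have "M \<le> kernel_form K V x"
    unfolding M_def kernel_form_def x_def mult.assoc
    by (intro sum_mono mult_left_mono nonneg) (metis abs_ge_self abs_mult)
  with unit[OF x1] have q: "kernel_form K V x = M" by (simp add: M_def)
  have "kernel_form K V z \<le> M * (\<Sum>u\<in>V. (z u)\<^sup>2)" for z
  proof (cases "(\<Sum>u\<in>V. (z u)\<^sup>2) = 0")
    case True
    then have "\<And>u. u \<in> V \<Longrightarrow> z u = 0" using fin by (simp add: sum_nonneg_eq_0_iff)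
    then have "kernel_form K V z = 0" by (simp add: kernel_form_def)
    with True show ?thesis by simp
  next
    case False
    define s where "s = (\<Sum>u\<in>V. (z u)\<^sup>2)"
    have s: "s > 0" using False sum_nonneg[of V "\<lambda>u. (z u)\<^sup>2"] unfolding s_def by force
    have "(\<Sum>u\<in>V. (1 / sqrt s * z u)\<^sup>2) = 1"
      using s by (simp add: power_mult_distrib power_divide flip: sum_divide_distrib)
        (simp add: s_def)
    from unit[OF this] have "kernel_form K V z / s \<le> M"
      using s unfolding kernel_form_scale by (simp add: M_def power_divide)
    then have "kernel_form K V z \<le> M * s" using s by (simp add: pos_divide_le_eq)
    then show ?thesis by (simp add: s_def)
  qed
  with x1 q show ?thesis by (intro exI[of _ x]) (simp add: x_def)
qed

text \<open>The maximum \<open>M\<close> of the form is an eigenvalue, with the maximiser as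
  eigenvector, hence at most \<open>\<rho>\<close>. Conversely, if \<open>v\<close> is a complex
  eigenvector for an eigenvalue of modulus \<open>\<rho>\<close>, the vector \<open>w\<close> of
  moduli satisfies \<open>\<rho> * w \<le> K w\<close> entrywise by the triangle inequality, and
  pairing with \<open>w\<close> gives \<open>\<rho> \<le> M\<close>.\<close>

lemma spectral_radius_rayleigh:
  assumes A: "A \<in> carrier_mat n n" and e: "bij_betw e {..<n} V" and n: "n > 0"
    and AK: "\<And>i j. i < n \<Longrightarrow> j < n \<Longrightarrow> A $$ (i, j) = K (e i) (e j)"
    and sym: "\<And>u v. K u v = K v u" and nonneg: "\<And>u v. K u v \<ge> (0::real)"
  defines "\<rho> \<equiv> spectral_radius (map_mat complex_of_real A)"
  shows spectral_radius_bound: "kernel_form K V z \<le> \<rho> * (\<Sum>u\<in>V. (z u)\<^sup>2)"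
    and spectral_radius_attained:
      "\<exists>x. (\<forall>u. x u \<ge> 0) \<and> (\<Sum>u\<in>V. (x u)\<^sup>2) = 1 \<and> kernel_form K V x = \<rho>"
proof -
  have fin: "finite V" using bij_betw_finite[OF e] by simp
  have ne: "V \<noteq> {}" using e n by (auto simp: bij_betw_def)
  obtain x where x: "(\<forall>u. x u \<ge> 0) \<and> (\<Sum>u\<in>V. (x u)\<^sup>2) = 1 \<and>
    (\<forall>z. kernel_form K V z \<le> kernel_form K V x * (\<Sum>u\<in>V. (z u)\<^sup>2))"
    using rayleigh_maximum[where K = K, OF fin ne nonneg] by (elim exE)
  define M where "M = kernel_form K V x"
  have x0: "x u \<ge> 0" for u using x by simp
  have x1: "(\<Sum>u\<in>V. (x u)\<^sup>2) = 1" using x by simp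
  have M: "kernel_form K V z \<le> M * (\<Sum>u\<in>V. (z u)\<^sup>2)" for z using x by (simp add: M_def)
  have eig: "(\<Sum>v\<in>V. K u v * x v) = M * x u" if "u \<in> V" for u
    using rayleigh_equality_imp_eigenvector[where K = K, OF fin sym M _ that, of x] x1 by (simp add: M_def)
  have M0: "M \<ge> 0"
    unfolding M_def kernel_form_def by (intro sum_nonneg mult_nonneg_nonneg nonneg x0)
  let ?C = "map_mat complex_of_real A"
  have C: "?C \<in> carrier_mat n n" using A by simp
  have Cx: "(?C *\<^sub>v v) $ i = (\<Sum>j<n. complex_of_real (K (e i) (e j)) * v $ j)"
    if "v \<in> carrier_vec n" "i < n" for v i
    using that A by (simp add: scalar_prod_def AK atLeast0LessThan)
  have mem: "e i \<in> V" if "i < n" for i using e that by (auto simp: bij_betw_def)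
  have reindex: "(\<Sum>j<n. f (e j)) = sum f V" for f :: "'a \<Rightarrow> real"
    by (rule sum.reindex_bij_betw[OF e])
  define v where "v = vec n (\<lambda>i. complex_of_real (x (e i)))"
  have vn: "v \<in> carrier_vec n" by (simp add: v_def)
  have "M \<le> \<rho>"
  proof -
    have "?C *\<^sub>v v = complex_of_real M \<cdot>\<^sub>v v"
    proof (rule eq_vecI)
      fix i assume "i < dim_vec (complex_of_real M \<cdot>\<^sub>v v)"
      then have i: "i < n" by (simp add: v_def)
      have "(?C *\<^sub>v v) $ i = complex_of_real (\<Sum>j<n. K (e i) (e j) * x (e j))"
        using i by (subst Cx) (simp_all add: v_def)
      also have "(\<Sum>j<n. K (e i) (e j) * x (e j)) = M * x (e i)"
        using reindex[of "\<lambda>w. K (e i) w * x w"] eig[OF mem[OF i]] by simp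
      finally show "(?C *\<^sub>v v) $ i = (complex_of_real M \<cdot>\<^sub>v v) $ i" using i by (simp add: v_def)
    qed (use A in \<open>simp add: v_def\<close>)
    moreover have "v \<noteq> 0\<^sub>v n"
    proof
      assume v0: "v = 0\<^sub>v n"
      have "x (e i) = 0" if "i < n" for i
        using arg_cong[OF v0, of "\<lambda>w. w $ i"] that by (simp add: v_def)
      then have "(\<Sum>u\<in>V. (x u)\<^sup>2) = 0" by (subst reindex[symmetric]) simp
      with x1 show False by simp
    qed
    ultimately have "eigenvalue ?C (complex_of_real M)"
      unfolding eigenvalue_def eigenvector_def using A vn by (intro exI[of _ v]) simp
    then have "norm (complex_of_real M) \<le> \<rho>"
      unfolding \<rho>_def by (intro spectral_radius_mem_max(2)[OF C n] imageI) (simp add: spectrum_def)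
    then show ?thesis using M0 by simp
  qed
  moreover have "\<rho> \<le> M"
  proof -
    obtain l where l: "l \<in> spectrum ?C" "\<rho> = norm l"
      using spectral_radius_mem_max(1)[OF C n] unfolding \<rho>_def by blast
    then obtain v where v: "v \<in> carrier_vec n" "v \<noteq> 0\<^sub>v n" "?C *\<^sub>v v = l \<cdot>\<^sub>v v"
      using A by (auto simp: spectrum_def eigenvalue_def eigenvector_def)
    define w where "w u = norm (v $ (the_inv_into {..<n} e u))" for u
    have w: "w (e i) = norm (v $ i)" if "i < n" for i
      using e that by (simp add: w_def bij_betw_def the_inv_into_f_f)
    have row: "\<rho> * w u \<le> (\<Sum>v\<in>V. K u v * w v)" if u: "u \<in> V" for u
    proof -
      obtain i where i: "i < n" "u = e i" using e u by (auto simp: bij_betw_def)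
      have "\<rho> * w u = norm ((?C *\<^sub>v v) $ i)" using i v l w by (simp add: norm_mult)
      also have "\<dots> \<le> (\<Sum>j<n. norm (complex_of_real (K (e i) (e j)) * v $ j))"
        unfolding Cx[OF v(1) i(1)] by (rule norm_sum)
      also have "\<dots> = (\<Sum>j<n. K (e i) (e j) * w (e j))"
        by (intro sum.cong) (auto simp: norm_mult w nonneg)
      also have "\<dots> = (\<Sum>v\<in>V. K u v * w v)" unfolding i by (rule reindex)
      finally show ?thesis .
    qed
    have "\<rho> * (\<Sum>u\<in>V. (w u)\<^sup>2) = (\<Sum>u\<in>V. w u * (\<rho> * w u))"
      by (simp add: sum_distrib_left power2_eq_square mult_ac)
    also have "\<dots> \<le> kernel_form K V w"
      unfolding kernel_form_row by (intro sum_mono mult_left_mono row) (simp_all add: w_def)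
    also have "\<dots> \<le> M * (\<Sum>u\<in>V. (w u)\<^sup>2)" by (rule M)
    finally have "\<rho> * (\<Sum>u\<in>V. (w u)\<^sup>2) \<le> M * (\<Sum>u\<in>V. (w u)\<^sup>2)" .
    moreover have "(\<Sum>u\<in>V. (w u)\<^sup>2) > 0"
    proof -
      obtain i where "i < n" "v $ i \<noteq> 0"
      proof (rule ccontr)
        assume "\<not> thesis"
        with that have "\<forall>i<n. v $ i = 0" by blast
        with v(1) have "v = 0\<^sub>v n" by (intro eq_vecI) simp_all
        with v(2) show False by simp
      qed
      then show ?thesis
        using mem[of i] w[of i] fin by (intro sum_pos2[of _ "e i"]) auto
    qed
    ultimately show ?thesis by simp
  qed
  ultimately have "\<rho> = M" by simp
  with M[of z] x0 x1 show "kernel_form K V z \<le> \<rho> * (\<Sum>u\<in>V. (z u)\<^sup>2)"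
    "\<exists>x. (\<forall>u. x u \<ge> 0) \<and> (\<Sum>u\<in>V. (x u)\<^sup>2) = 1 \<and> kernel_form K V x = \<rho>"
    by (simp, intro exI[of _ x]) (simp add: M_def)
qed

section \<open>The quadratic form of a graph\<close>

text \<open>This is the quadratic form of the matrix: the square at \<open>u\<close> occurs once for
  each arc leaving \<open>u\<close>, which produces the degree. As a sum over arcs it splits
  whenever the arc set does, and no degrees have to be tracked.\<close>

definition arc_form :: "real \<Rightarrow> ('a \<times> 'a) set \<Rightarrow> ('a \<Rightarrow> real) \<Rightarrow> real" where
  "arc_form \<alpha> E x = (\<Sum>(u, v)\<in>E. \<alpha> * (x u)\<^sup>2 + (1 - \<alpha>) * (x u * x v))"

definition alpha_kernel :: "real \<Rightarrow> ('a \<times> 'a) set \<Rightarrow> 'a \<Rightarrow> 'a \<Rightarrow> real" where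
  "alpha_kernel \<alpha> E u v = (if u = v then \<alpha> * card (E `` {u}) else 0) +
     (1 - \<alpha>) * (if (u, v) \<in> E then 1 else 0)"

text \<open>The degree term is distributed over the neighbours, one share each. All eigenvalue
  equations below are used in this form.\<close>

lemma alpha_kernel_row:
  assumes V: "finite V" "E \<subseteq> V \<times> V" and u: "u \<in> V"
  shows "(\<Sum>v\<in>V. alpha_kernel \<alpha> E u v * x v) = (\<Sum>v\<in>E `` {u}. \<alpha> * x u + (1 - \<alpha>) * x v)"
proof -
  have "(\<Sum>v\<in>V. alpha_kernel \<alpha> E u v * x v) =
    (\<Sum>v\<in>V. (if v = u then \<alpha> * card (E `` {u}) * x u else 0) +
      (if (u, v) \<in> E then (1 - \<alpha>) * x v else 0))"
    by (intro sum.cong) (auto simp: alpha_kernel_def algebra_simps)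
  also have "\<dots> = \<alpha> * card (E `` {u}) * x u + (\<Sum>v\<in>V. if (u, v) \<in> E then (1 - \<alpha>) * x v else 0)"
    using V u by (simp add: sum.distrib)
  also have "(\<Sum>v\<in>V. if (u, v) \<in> E then (1 - \<alpha>) * x v else 0) = (\<Sum>v\<in>E `` {u}. (1 - \<alpha>) * x v)"
    using V by (intro sum.mono_neutral_cong_right) auto
  finally show ?thesis by (simp add: sum.distrib)
qed

lemma arc_form_Sigma:
  assumes "finite V" "E \<subseteq> V \<times> V"
  shows "arc_form \<alpha> E x = (\<Sum>u\<in>V. \<Sum>v\<in>E `` {u}. \<alpha> * (x u)\<^sup>2 + (1 - \<alpha>) * (x u * x v))"
proof -
  have "E = Sigma V (\<lambda>u. E `` {u})" using assms by auto
  moreover have "finite (E `` {u})" for u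
    by (rule finite_subset[of _ V]) (use assms in auto)
  ultimately show ?thesis
    unfolding arc_form_def using assms(1) by (subst sum.Sigma) auto
qed

lemma kernel_form_alpha_kernel:
  assumes "finite V" "E \<subseteq> V \<times> V"
  shows "kernel_form (alpha_kernel \<alpha> E) V x = arc_form \<alpha> E x"
  unfolding kernel_form_row arc_form_Sigma[OF assms]
  by (intro sum.cong refl, simp only: alpha_kernel_row[OF assms] sum_distrib_left)
    (simp add: algebra_simps power2_eq_square)

context
  fixes G :: "'a pair_pre_digraph" and \<alpha> :: real
  assumes G: "pair_graph G" and ne: "pverts G \<noteq> {}" and \<alpha>0: "0 \<le> \<alpha>" and \<alpha>1: "\<alpha> < 1"
begin

interpretation pair_graph G by (rule G)

lemma parcs_sub: "parcs G \<subseteq> pverts G \<times> pverts G"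
  using in_arcsD1 in_arcsD2 by auto

lemma alpha_mat_entry:
  assumes "i < card (pverts G)" "j < card (pverts G)"
  shows "alpha_mat \<alpha> G $$ (i, j) = alpha_kernel \<alpha> (parcs G) (vert_enum G i) (vert_enum G j)"
proof -
  have inj: "inj_on (vert_enum G) {..<card (pverts G)}"
    using someI_ex[OF ex_bij_betw_nat_finite[OF pair_finite_verts]]
    by (simp add: vert_enum_def bij_betw_def atLeast0LessThan)
  have "out_arcs (with_proj G) u = Pair u ` (parcs G `` {u})" for u
    by (auto simp: out_arcs_def)
  then have "out_degree (with_proj G) u = card (parcs G `` {u})" for u
    by (simp add: out_degree_def card_image inj_on_def)
  then show ?thesis
    using assms inj
    by (auto simp: alpha_mat_def degree_mat_def adjacency_mat_def alpha_kernel_def inj_on_def)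
qed

lemma rho_alpha_rayleigh:
  shows rho_alpha_bound: "arc_form \<alpha> (parcs G) z \<le> rho_alpha \<alpha> G * (\<Sum>u\<in>pverts G. (z u)\<^sup>2)"
    and rho_alpha_attained: "\<exists>x. (\<forall>u. x u \<ge> 0) \<and> (\<Sum>u\<in>pverts G. (x u)\<^sup>2) = 1 \<and>
      arc_form \<alpha> (parcs G) x = rho_alpha \<alpha> G"
    and rho_alpha_eigenvector: "arc_form \<alpha> (parcs G) z = rho_alpha \<alpha> G * (\<Sum>u\<in>pverts G. (z u)\<^sup>2) \<Longrightarrow>
      u \<in> pverts G \<Longrightarrow> (\<Sum>v\<in>parcs G `` {u}. \<alpha> * z u + (1 - \<alpha>) * z v) = rho_alpha \<alpha> G * z u"
proof -
  let ?K = "alpha_kernel \<alpha> (parcs G)" and ?n = "card (pverts G)"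
  have bij: "bij_betw (vert_enum G) {..<?n} (pverts G)"
    using someI_ex[OF ex_bij_betw_nat_finite[OF pair_finite_verts]]
    by (simp add: vert_enum_def atLeast0LessThan)
  have A: "alpha_mat \<alpha> G \<in> carrier_mat ?n ?n"
    by (simp add: alpha_mat_def degree_mat_def adjacency_mat_def)
  have n: "?n > 0" using ne pair_finite_verts by (simp add: card_gt_0_iff)
  have sym: "?K u v = ?K v u" for u v
    using arcs_symmetric by (auto simp: alpha_kernel_def)
  have nonneg: "?K u v \<ge> 0" for u v
    using \<alpha>0 \<alpha>1 by (simp add: alpha_kernel_def)
  note form = kernel_form_alpha_kernel[OF pair_finite_verts parcs_sub]
  have bound: "kernel_form ?K (pverts G) z \<le> rho_alpha \<alpha> G * (\<Sum>u\<in>pverts G. (z u)\<^sup>2)" for z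
    unfolding rho_alpha_def
    by (rule spectral_radius_bound[where K = ?K, OF A bij n]) (fact alpha_mat_entry sym nonneg)+
  then show "arc_form \<alpha> (parcs G) z \<le> rho_alpha \<alpha> G * (\<Sum>u\<in>pverts G. (z u)\<^sup>2)" for z
    by (simp only: form)
  show "\<exists>x. (\<forall>u. x u \<ge> 0) \<and> (\<Sum>u\<in>pverts G. (x u)\<^sup>2) = 1 \<and>
      arc_form \<alpha> (parcs G) x = rho_alpha \<alpha> G"
    unfolding rho_alpha_def form[symmetric]
    by (rule spectral_radius_attained[where K = ?K, OF A bij n]) (fact alpha_mat_entry sym nonneg)+
  assume eq: "arc_form \<alpha> (parcs G) z = rho_alpha \<alpha> G * (\<Sum>u\<in>pverts G. (z u)\<^sup>2)"
    and u: "u \<in> pverts G"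
  show "(\<Sum>v\<in>parcs G `` {u}. \<alpha> * z u + (1 - \<alpha>) * z v) = rho_alpha \<alpha> G * z u"
    unfolding alpha_kernel_row[OF pair_finite_verts parcs_sub u, symmetric]
    by (rule rayleigh_equality_imp_eigenvector[where K = ?K, OF pair_finite_verts sym bound _ u])
      (simp only: form eq)
qed

text \<open>A nonnegative maximiser satisfies the eigenvalue equation. At a zero of \<open>x\<close>
  that equation says that a sum of nonnegative neighbouring values, with factor 1 - \<alpha> > 0,
  vanishes; so zeros spread along arcs, and in a connected graph one zero would make
  \<open>x\<close> vanish.\<close>

lemma rho_alpha_positive_vector:
  assumes conn: "Digraph_Component.connected (with_proj G)"
  shows "\<exists>x. (\<forall>u\<in>pverts G. x u > 0) \<and> (\<Sum>u\<in>pverts G. (x u)\<^sup>2) = 1 \<and>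
      arc_form \<alpha> (parcs G) x = rho_alpha \<alpha> G"
proof -
  obtain x where x: "\<forall>u. x u \<ge> 0" "(\<Sum>u\<in>pverts G. (x u)\<^sup>2) = 1" "arc_form \<alpha> (parcs G) x = rho_alpha \<alpha> G"
    using rho_alpha_attained by (elim exE conjE)
  have step: "x v = 0" if "(u, v) \<in> parcs G" "x u = 0" for u v
  proof -
    have "(\<Sum>v\<in>parcs G `` {u}. (1 - \<alpha>) * x v) = 0"
      using rho_alpha_eigenvector[of x u] x that in_arcsD1 by simp
    moreover have "finite (parcs G `` {u})"
      by (rule finite_subset[of _ "pverts G"]) (use pair_finite_verts parcs_sub in auto)
    ultimately have "\<forall>v\<in>parcs G `` {u}. (1 - \<alpha>) * x v = 0"
      using x(1) \<alpha>1 by (simp add: sum_nonneg_eq_0_iff)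
    then show ?thesis using that \<alpha>1 by auto
  qed
  have "x u > 0" if u: "u \<in> pverts G" for u
  proof (rule ccontr)
    assume "\<not> x u > 0"
    with x(1) have 0: "x u = 0" by (simp add: not_less order_antisym)
    have "x v = 0" if v: "v \<in> pverts G" for v
    proof -
      have "symmetric (with_proj G)" using pair_sym_arcs .
      with conn have "strongly_connected (with_proj G)"
        by (intro symmetric_connected_imp_strongly_connected)
      then have "(u, v) \<in> (parcs G)\<^sup>*"
        using u v rtrancl_on_sub_rtrancl[of "pverts G" "parcs G"]
        by (auto simp: strongly_connected_def reachable_def)
      then show ?thesis by (induction rule: rtrancl_induct) (auto intro: 0 step)
    qed
    then show False using x(2) by simp
  qed
  with x show ?thesis by blast
qed

end

section \<open>A rearrangement inequality on paths\<close>

fun adjacent_sum :: "real list \<Rightarrow> real" where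
  "adjacent_sum (x # y # zs) = x * y + adjacent_sum (y # zs)"
| "adjacent_sum _ = 0"

lemma adjacent_sum_Cons:
  assumes "ys \<noteq> []"
  shows "adjacent_sum (x # ys) = x * hd ys + adjacent_sum ys"
  using assms by (cases ys) auto

lemma adjacent_sum_append:
  assumes "xs \<noteq> []" "ys \<noteq> []"
  shows "adjacent_sum (xs @ ys) = adjacent_sum xs + last xs * hd ys + adjacent_sum ys"
  using assms
  by (induction xs rule: adjacent_sum.induct) (auto simp: adjacent_sum_Cons)

lemma adjacent_sum_map_upt:
  "adjacent_sum (map f [0..<Suc k]) = (\<Sum>j<k. f j * f (Suc j))"
proof (induction k)
  case (Suc k)
  have "map f [0..<Suc (Suc k)] = map f [0..<Suc k] @ [f (Suc k)]" by simp
  moreover have "adjacent_sum (map f [0..<Suc k] @ [f (Suc k)]) =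
      adjacent_sum (map f [0..<Suc k]) + f k * f (Suc k)"
    by (subst adjacent_sum_append) simp_all
  ultimately show ?case using Suc by (simp only: sum.lessThan_Suc)
qed simp

text \<open>
  Inserting a new least entry \<open>z\<close> between \<open>b\<close> and \<open>c\<close> into a cyclic arrangement changes the sum of
  adjacent products by \<open>z\<^sup>2 - (b - z) * (c - z)\<close>, which is largest if \<open>b\<close> and \<open>c\<close> are the next
  smallest entries.
\<close>

lemma cyclic_sum_le:
  fixes a :: "nat \<Rightarrow> real"
  assumes anti: "antimono a" and "distinct js" "set js = {..<Suc (Suc m)}"
  shows "adjacent_sum (map a js) + a (last js) * a (hd js) \<le>
    a 0 * a 1 + (\<Sum>i<m. a i * a (i + 2)) + a m * a (Suc m)"
  using assms(2,3)
proof (induction m arbitrary: js)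
  case 0
  then have "length js = 2" using distinct_card[of js] by simp
  then obtain i j where "js = [i, j]" by (auto simp: length_Suc_conv numeral_2_eq_2)
  with 0 have "{i, j} = {0, 1}" by (simp add: lessThan_Suc insert_commute)
  then have "i = 0 \<and> j = 1 \<or> i = 1 \<and> j = 0" by (simp add: doubleton_eq_iff)
  then show ?case using \<open>js = [i, j]\<close> by auto
next
  case (Suc m)
  define N where "N = Suc (Suc m)"
  have "N \<in> set js" using Suc.prems by (simp add: N_def)
  then obtain us vs where js: "js = us @ N # vs" by (auto simp: in_set_conv_decomp)
  \<comment> \<open>The cycle is cut open at the least entry \<open>N\<close>: \<open>ks\<close>
    lists the rest, starting just after \<open>N\<close>, so the two neighbours of \<open>N\<close>
    are its first and last entries.\<close>
  define ks where "ks = vs @ us"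
  have dist: "distinct ks" and "N \<notin> set ks" using Suc.prems js by (auto simp: ks_def)
  moreover have "insert N (set ks) = {..<Suc N}" using Suc.prems js by (auto simp: ks_def N_def)
  ultimately have set: "set ks = {..<Suc (Suc m)}"
    unfolding N_def[symmetric] lessThan_Suc by (subst (asm) insert_ident) simp_all
  have len: "length ks = Suc (Suc m)" using dist set distinct_card[of ks] by simp
  then have ne: "ks \<noteq> []" by auto
  let ?b = "a (hd ks)" and ?c = "a (last ks)"
  have C: "adjacent_sum (map a js) + a (last js) * a (hd js) =
    adjacent_sum (map a ks) + a N * (?b + ?c)"
  proof (cases "us = [] \<or> vs = []")
    case True
    then show ?thesis using ne
      by (auto simp: js ks_def adjacent_sum_Cons adjacent_sum_append hd_map last_map algebra_simps)
  next
    case False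
    then show ?thesis
      by (simp add: js ks_def adjacent_sum_Cons adjacent_sum_append hd_map last_map algebra_simps)
  qed
  \<comment> \<open>Two different indices below \<open>m + 2\<close> cannot both be
    \<open>m + 1\<close>, so the neighbours of \<open>N\<close> dominate \<open>a m\<close> and
    \<open>a (Suc m)\<close> in some order.\<close>
  have "hd ks \<noteq> last ks"
  proof
    assume "hd ks = last ks"
    then have "ks ! 0 = ks ! Suc m" using ne len by (simp add: hd_conv_nth last_conv_nth)
    then show False using dist len by (simp add: nth_eq_iff_index_eq)
  qed
  moreover have "hd ks < Suc (Suc m)" "last ks < Suc (Suc m)"
    using hd_in_set[OF ne] last_in_set[OF ne] unfolding set by simp_all
  ultimately consider "hd ks \<le> m" "last ks \<le> Suc m" | "hd ks \<le> Suc m" "last ks \<le> m"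
    by linarith
  then have "(a m - a N) * (a (Suc m) - a N) \<le> (?b - a N) * (?c - a N)"
  proof cases
    case 1
    then show ?thesis using anti
      by (intro mult_mono diff_right_mono) (auto simp: N_def intro!: antimonoD[OF anti])
  next
    case 2
    then show ?thesis using anti
      by (subst mult.commute, intro mult_mono diff_right_mono)
        (auto simp: N_def intro!: antimonoD[OF anti])
  qed
  then have "a N * (?b + ?c) - ?b * ?c \<le> a N * (a m + a (Suc m)) - a m * a (Suc m)"
    by (simp add: algebra_simps)
  with Suc.IH[OF dist set] C show ?case by (simp add: N_def algebra_simps)
qed

text \<open>A path is closed to a cycle by the extra index \<open>k + 1\<close>, whose value is
  zero; both products at the new entry vanish, and so does the last term of the cyclic
  bound.\<close>

lemma path_sum_le:
  fixes a :: "nat \<Rightarrow> real"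
  assumes anti: "antimono a" and zero: "\<And>i. i > k \<Longrightarrow> a i = 0" and \<sigma>: "bij_betw \<sigma> {..k} {..k}"
  shows "(\<Sum>j<k. a (\<sigma> j) * a (\<sigma> (Suc j))) \<le> a 0 * a 1 + (\<Sum>i<k - 1. a i * a (i + 2))"
proof -
  define js where "js = map \<sigma> [0..<Suc k]"
  have ne: "js \<noteq> []" by (simp add: js_def)
  have set: "set js = {..k}"
    using \<sigma> by (simp add: js_def bij_betw_def atLeast0LessThan lessThan_Suc_atMost del: upt_Suc)
  have dist: "distinct js"
    using \<sigma> by (simp add: js_def distinct_map bij_betw_def atLeast0LessThan lessThan_Suc_atMost del: upt_Suc)
  have "adjacent_sum (map a (Suc k # js)) + a (last (Suc k # js)) * a (hd (Suc k # js)) \<le>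
    a 0 * a 1 + (\<Sum>i<k. a i * a (i + 2)) + a k * a (Suc k)"
  proof (rule cyclic_sum_le[OF anti])
    show "distinct (Suc k # js)" using dist set by simp
    show "set (Suc k # js) = {..<Suc (Suc k)}" using set by (simp add: lessThan_Suc_atMost atMost_Suc)
  qed
  moreover have "(\<Sum>i<k. a i * a (i + 2)) = (\<Sum>i<k - 1. a i * a (i + 2))"
    by (cases k) (auto simp: zero)
  ultimately have "adjacent_sum (map a js) \<le> a 0 * a 1 + (\<Sum>i<k - 1. a i * a (i + 2))"
    using ne by (simp add: adjacent_sum_Cons zero)
  then show ?thesis
    using adjacent_sum_map_upt[of "a \<circ> \<sigma>" k] by (simp add: js_def del: upt_Suc)
qed

text \<open>Contribution of one undirected edge, that is, of both its arcs, to the quadratic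
  form.\<close>

definition edge_weight :: "real \<Rightarrow> real \<Rightarrow> real \<Rightarrow> real" where
  "edge_weight \<alpha> b c = \<alpha> * (b\<^sup>2 + c\<^sup>2) + 2 * (1 - \<alpha>) * (b * c)"

lemma edge_weight_mono:
  assumes "0 \<le> \<alpha>" "\<alpha> < 1" "0 \<le> b" "0 \<le> c" "c \<le> d"
  shows "edge_weight \<alpha> b c \<le> edge_weight \<alpha> b d"
  using assms unfolding edge_weight_def
  by (intro add_mono mult_left_mono power_mono) auto

lemma edge_weight_strict_mono:
  assumes "0 \<le> \<alpha>" "\<alpha> < 1" "0 < b" "0 \<le> c" "c < d"
  shows "edge_weight \<alpha> b c < edge_weight \<alpha> b d"
  using assms unfolding edge_weight_def
  by (intro add_le_less_mono mult_left_mono mult_strict_left_mono) (auto intro!: power_mono)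

lemma edge_weight_pos:
  assumes "0 \<le> \<alpha>" "\<alpha> < 1" "0 < b" "0 < c"
  shows "0 < edge_weight \<alpha> b c"
  using assms unfolding edge_weight_def by (intro add_nonneg_pos) auto

lemma edge_weight_nonneg:
  assumes "0 \<le> \<alpha>" "\<alpha> < 1" "0 \<le> b" "0 \<le> c"
  shows "0 \<le> edge_weight \<alpha> b c"
  using assms unfolding edge_weight_def by (intro add_nonneg_nonneg) auto

text \<open>The products are handled by \<open>path_sum_le\<close>. Among the squares every entry is
  counted twice except the two at the ends of the path; the alternating arrangement has the two
  smallest entries there and so loses least.\<close>

lemma path_weight_le:
  fixes a :: "nat \<Rightarrow> real"
  assumes anti: "antimono a" and nonneg: "\<And>i. a i \<ge> 0" and zero: "\<And>i. i > k \<Longrightarrow> a i = 0"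
    and \<sigma>: "bij_betw \<sigma> {..k} {..k}" and k: "k \<ge> 1" and \<alpha>: "0 \<le> \<alpha>" "\<alpha> < 1"
  shows "(\<Sum>j<k. edge_weight \<alpha> (a (\<sigma> j)) (a (\<sigma> (Suc j)))) \<le>
    edge_weight \<alpha> (a 0) (a 1) + (\<Sum>i<k - 1. edge_weight \<alpha> (a i) (a (i + 2)))"
proof -
  obtain l where l: "k = Suc l" using k by (cases k) auto
  have tot: "(\<Sum>j\<le>k. (a (\<sigma> j))\<^sup>2) = (\<Sum>i\<le>k. (a i)\<^sup>2)"
    by (rule sum.reindex_bij_betw[OF \<sigma>])
  have L: "(\<Sum>j<k. (a (\<sigma> j))\<^sup>2 + (a (\<sigma> (Suc j)))\<^sup>2) =
    2 * (\<Sum>i\<le>k. (a i)\<^sup>2) - ((a (\<sigma> 0))\<^sup>2 + (a (\<sigma> k))\<^sup>2)"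
    using tot sum.atMost_Suc_shift[of "\<lambda>j. (a (\<sigma> j))\<^sup>2" l] sum.atMost_Suc[of "\<lambda>j. (a (\<sigma> j))\<^sup>2" l]
    unfolding sum.distrib l lessThan_Suc_atMost by linarith
  have R: "(a 0)\<^sup>2 + (a 1)\<^sup>2 + (\<Sum>i<k - 1. (a i)\<^sup>2 + (a (i + 2))\<^sup>2) =
    2 * (\<Sum>i\<le>k. (a i)\<^sup>2) - ((a l)\<^sup>2 + (a k)\<^sup>2)"
    unfolding l by (induction l) (simp_all add: numeral_2_eq_2)
  have inj: "\<sigma> 0 \<noteq> \<sigma> k" "\<sigma> 0 \<le> k" "\<sigma> k \<le> k"
    using \<sigma> k by (auto simp: bij_betw_def inj_on_def)
  have sq: "(a i)\<^sup>2 \<le> (a j)\<^sup>2" if "j \<le> i" for i j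
    using antimonoD[OF anti that] nonneg by (intro power_mono) auto
  from inj consider "\<sigma> 0 \<le> l" "\<sigma> k \<le> k" | "\<sigma> k \<le> l" "\<sigma> 0 \<le> k"
    unfolding l by linarith
  then have "(a l)\<^sup>2 + (a k)\<^sup>2 \<le> (a (\<sigma> 0))\<^sup>2 + (a (\<sigma> k))\<^sup>2"
    by cases (use sq in \<open>smt (verit)\<close>)+
  with L R have "\<alpha> * (\<Sum>j<k. (a (\<sigma> j))\<^sup>2 + (a (\<sigma> (Suc j)))\<^sup>2) \<le>
    \<alpha> * ((a 0)\<^sup>2 + (a 1)\<^sup>2 + (\<Sum>i<k - 1. (a i)\<^sup>2 + (a (i + 2))\<^sup>2))"
    using \<alpha> by (intro mult_left_mono) auto
  moreover have "2 * (1 - \<alpha>) * (\<Sum>j<k. a (\<sigma> j) * a (\<sigma> (Suc j))) \<le>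
    2 * (1 - \<alpha>) * (a 0 * a 1 + (\<Sum>i<k - 1. a i * a (i + 2)))"
    using \<alpha> path_sum_le[OF anti zero \<sigma>] by (intro mult_left_mono) auto
  ultimately show ?thesis
    unfolding edge_weight_def sum.distrib sum_distrib_left[symmetric] by (simp add: algebra_simps)
qed

text \<open>After subtracting \<open>h 2\<close> from every value, indices below 3 contribute at
  least zero and the others at most zero, while \<open>h 2 \<ge> 0\<close> pays for missing
  elements. If \<open>h 3 < h 2\<close>, later indices lose strictly, so equality leaves a subset of
  \<open>{..<3}\<close>, and \<open>0 < h 2\<close> forces three elements. Ties among the first
  three values do no harm.\<close>

lemma top_three_le:
  fixes h :: "nat \<Rightarrow> real"
  assumes S: "finite S" "card S \<le> 3" and anti: "antimono h" and nonneg: "h 2 \<ge> 0"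
  shows "sum h S \<le> sum h {..<3}"
    and "sum h S = sum h {..<3} \<Longrightarrow> h 3 < h 2 \<Longrightarrow> 0 < h 2 \<Longrightarrow> S = {..<3}"
proof -
  have split: "sum h A = (\<Sum>i\<in>A. h i - h 2) + card A * h 2" if "finite A" for A
    by (simp add: sum_subtractf)
  have mono: "h i \<le> h 2" if "i \<ge> 2" for i using antimonoD[OF anti that] .
  have mono': "h 2 \<le> h i" if "i < 3" for i using antimonoD[OF anti, of i 2] that by simp
  have S1: "(\<Sum>i\<in>S. h i - h 2) = (\<Sum>i\<in>S \<inter> {..<3}. h i - h 2) + (\<Sum>i\<in>S - {..<3}. h i - h 2)"
    using S by (subst sum.union_disjoint[symmetric]) (auto intro: sum.cong)
  have S2: "(\<Sum>i\<in>S \<inter> {..<3}. h i - h 2) \<le> (\<Sum>i<3. h i - h 2)"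
    by (intro sum_mono2) (auto simp: mono')
  have S3: "(\<Sum>i\<in>S - {..<3}. h i - h 2) \<le> 0"
    by (intro sum_nonpos) (auto simp: mono)
  have S4: "card S * h 2 \<le> 3 * h 2" using S nonneg by (intro mult_right_mono) auto
  show "sum h S \<le> sum h {..<3}"
    using split[of S] split[of "{..<3}"] S S1 S2 S3 S4 by simp
  assume eq: "sum h S = sum h {..<3}" and strict: "h 3 < h 2" "0 < h 2"
  have "sum h {..<3} = (\<Sum>i<3. h i - h 2) + 3 * h 2" using split[of "{..<3}"] by simp
  with eq split[OF S(1)] S1 S2 S3 S4
  have "(\<Sum>i\<in>S - {..<3}. h i - h 2) = 0" and c: "card S * h 2 = 3 * h 2"
    by linarith+
  moreover have "h i - h 2 < 0" if "i \<ge> 3" for i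
    using antimonoD[OF anti that] strict by simp
  ultimately have "S - {..<3} = {}"
    using sum_strict_mono[of "S - {..<3}" "\<lambda>i. h i - h 2" "\<lambda>_. 0"] S by force
  moreover have "card S = 3" using c strict by simp
  ultimately show "S = {..<3}" by (intro card_subset_eq) auto
qed

section \<open>Isomorphism invariance of the spectral radius\<close>

lemma arc_form_reindex:
  assumes "inj_on h V" "E \<subseteq> V \<times> V"
  shows "arc_form \<alpha> (map_prod h h ` E) x = arc_form \<alpha> E (x \<circ> h)"
proof -
  have "inj_on (map_prod h h) E"
    using inj_on_subset[OF map_prod_inj_on[OF assms(1,1)] assms(2)] .
  then show ?thesis
    unfolding arc_form_def by (subst sum.reindex) (auto intro!: sum.cong simp: o_def)
qed

text \<open>A digraph isomorphism also carries maps for arcs, heads and tails. Here arcs are pairs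
  and the projections are head and tail on both sides, so the arc map is determined by the vertex
  map.\<close>

lemma digraph_iso_with_proj_iff:
  assumes G: "pair_wf_digraph G" and H: "pair_wf_digraph H"
  shows "digraph_iso (with_proj G) (with_proj H) \<longleftrightarrow>
    (\<exists>h. bij_betw h (pverts G) (pverts H) \<and> parcs H = map_prod h h ` parcs G)"
proof
  assume "digraph_iso (with_proj G) (with_proj H)"
  then obtain f where f: "pre_digraph.digraph_isomorphism (with_proj G) f"
    and eq: "with_proj H = app_iso f (with_proj G)"
    by (auto simp: digraph_iso_def)
  have V: "pverts H = iso_verts f ` pverts G" using arg_cong[OF eq, of verts] by simp
  have E: "parcs H = iso_arcs f ` parcs G" using arg_cong[OF eq, of arcs] by simp
  have t: "fst = iso_tail f" using arg_cong[OF eq, of tail] by simp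
  have hd: "snd = iso_head f" using arg_cong[OF eq, of head] by simp
  have "iso_arcs f e = map_prod (iso_verts f) (iso_verts f) e" if "e \<in> parcs G" for e
    using f that unfolding pre_digraph.digraph_isomorphism_def t[symmetric] hd[symmetric]
    by (auto simp: prod_eq_iff)
  then have "parcs H = map_prod (iso_verts f) (iso_verts f) ` parcs G"
    unfolding E by (intro image_cong) auto
  moreover have "bij_betw (iso_verts f) (pverts G) (pverts H)"
    using f V by (simp add: pre_digraph.digraph_isomorphism_def bij_betw_def)
  ultimately show "\<exists>h. bij_betw h (pverts G) (pverts H) \<and> parcs H = map_prod h h ` parcs G"
    by blast
next
  assume "\<exists>h. bij_betw h (pverts G) (pverts H) \<and> parcs H = map_prod h h ` parcs G"
  then obtain h where h: "bij_betw h (pverts G) (pverts H)" "parcs H = map_prod h h ` parcs G"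
    by blast
  define f where "f = \<lparr> iso_verts = h, iso_arcs = map_prod h h, iso_head = snd, iso_tail = fst \<rparr>"
  have sub: "parcs G \<subseteq> pverts G \<times> pverts G"
    using pair_wf_digraph.in_arcsD1[OF G] pair_wf_digraph.in_arcsD2[OF G] by auto
  have inj: "inj_on h (pverts G)" using h by (simp add: bij_betw_def)
  have "inj_on (map_prod h h) (parcs G)"
    using inj_on_subset[OF map_prod_inj_on[OF inj inj] sub] .
  then have "pre_digraph.digraph_isomorphism (with_proj G) f"
    using inj G by (simp add: pre_digraph.digraph_isomorphism_def f_def wf_digraph_wp_iff)
  moreover have "with_proj H = app_iso f (with_proj G)"
    using h by (simp add: app_iso_def f_def with_proj_def bij_betw_def)
  ultimately show "digraph_iso (with_proj G) (with_proj H)"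
    unfolding digraph_iso_def by blast
qed

lemma rho_alpha_le_if_bij:
  assumes G: "pair_graph G" "pverts G \<noteq> {}" and H: "pair_graph H" "pverts H \<noteq> {}"
    and \<alpha>: "0 \<le> \<alpha>" "\<alpha> < 1"
    and h: "bij_betw h (pverts H) (pverts G)" "parcs G = map_prod h h ` parcs H"
  shows "rho_alpha \<alpha> G \<le> rho_alpha \<alpha> H"
proof -
  obtain x where x: "(\<Sum>u\<in>pverts G. (x u)\<^sup>2) = 1" "arc_form \<alpha> (parcs G) x = rho_alpha \<alpha> G"
    using rho_alpha_attained[OF G \<alpha>] by auto
  have "(\<Sum>u\<in>pverts H. ((x \<circ> h) u)\<^sup>2) = 1"
    using sum.reindex_bij_betw[OF h(1), of "\<lambda>u. (x u)\<^sup>2"] x by simp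
  moreover have "arc_form \<alpha> (parcs H) (x \<circ> h) = rho_alpha \<alpha> G"
    unfolding x(2)[symmetric] h(2) using h(1)
    by (intro arc_form_reindex[OF _ parcs_sub[OF H \<alpha>], symmetric]) (simp add: bij_betw_def)
  ultimately show ?thesis using rho_alpha_bound[OF H \<alpha>, of "x \<circ> h"] by simp
qed

lemma rho_alpha_iso:
  assumes G: "pair_graph G" "pverts G \<noteq> {}" and H: "pair_graph H" "pverts H \<noteq> {}"
    and \<alpha>: "0 \<le> \<alpha>" "\<alpha> < 1" and iso: "digraph_iso (with_proj G) (with_proj H)"
  shows "rho_alpha \<alpha> G = rho_alpha \<alpha> H"
proof -
  have wf: "pair_wf_digraph G" "pair_wf_digraph H"
    using G H by (simp_all add: pair_graph_def pair_digraph_def pair_fin_digraph_def)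
  have wfd: "wf_digraph (with_proj G)" using wf by (simp add: wf_digraph_wp_iff)
  from iso have "rho_alpha \<alpha> H \<le> rho_alpha \<alpha> G"
    unfolding digraph_iso_with_proj_iff[OF wf] by (auto intro: rho_alpha_le_if_bij[OF H G \<alpha>])
  moreover from digraph_iso_swap[OF wfd iso] have "rho_alpha \<alpha> G \<le> rho_alpha \<alpha> H"
    unfolding digraph_iso_with_proj_iff[OF wf(2,1)] by (auto intro: rho_alpha_le_if_bij[OF G H \<alpha>])
  ultimately show ?thesis by simp
qed

section \<open>Splitting the form along a partition of the vertices\<close>

lemma arc_form_Un:
  assumes "finite E" "finite F" "E \<inter> F = {}"
  shows "arc_form \<alpha> (E \<union> F) x = arc_form \<alpha> E x + arc_form \<alpha> F x"
  unfolding arc_form_def using assms by (rule sum.union_disjoint)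

lemma arc_form_symmetric_closure:
  assumes "finite F" "F \<inter> F\<inverse> = {}"
  shows "arc_form \<alpha> (F \<union> F\<inverse>) x = (\<Sum>(u, v)\<in>F. edge_weight \<alpha> (x u) (x v))"
proof -
  have "arc_form \<alpha> (F\<inverse>) x = (\<Sum>(u, v)\<in>F. \<alpha> * (x v)\<^sup>2 + (1 - \<alpha>) * (x v * x u))"
    unfolding arc_form_def
    by (rule sum.reindex_bij_witness[of _ prod.swap prod.swap]) auto
  then have "arc_form \<alpha> (F \<union> F\<inverse>) x = (\<Sum>e\<in>F. (\<lambda>(u, v). \<alpha> * (x u)\<^sup>2 + (1 - \<alpha>) * (x u * x v)) e +
      (\<lambda>(u, v). \<alpha> * (x v)\<^sup>2 + (1 - \<alpha>) * (x v * x u)) e)"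
    using assms by (simp add: arc_form_Un) (simp add: arc_form_def sum.distrib)
  also have "\<dots> = (\<Sum>(u, v)\<in>F. edge_weight \<alpha> (x u) (x v))"
    by (intro sum.cong) (auto simp: edge_weight_def algebra_simps)
  finally show ?thesis .
qed

lemma arc_form_split:
  assumes fin: "finite P" "finite W" and disj: "P \<inter> W = {}"
    and sub: "E \<subseteq> (P \<union> W) \<times> (P \<union> W)" and sym: "sym E"
  shows "arc_form \<alpha> E x = arc_form \<alpha> (E \<inter> P \<times> P) x + arc_form \<alpha> (E \<inter> W \<times> W) x +
    (\<Sum>w\<in>W. \<Sum>v\<in>E `` {w} \<inter> P. edge_weight \<alpha> (x w) (x v))"
proof -
  \<comment> \<open>Each cross edge is oriented from \<open>W\<close> to \<open>P\<close>, so that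
    the cross sum can be grouped by its end in \<open>W\<close>.\<close>
  define F where "F = E \<inter> W \<times> P"
  define A where "A = E \<inter> P \<times> P"
  define B where "B = E \<inter> W \<times> W"
  have finE: "finite E" using finite_subset[OF sub] fin by simp
  then have fins: "finite A" "finite B" "finite F" by (simp_all add: A_def B_def F_def)
  have E: "E = A \<union> (B \<union> (F \<union> F\<inverse>))"
    using sub sym by (auto simp: A_def B_def F_def dest: symD)
  have "A \<inter> (B \<union> (F \<union> F\<inverse>)) = {}" "B \<inter> (F \<union> F\<inverse>) = {}"
    using disj by (auto simp: A_def B_def F_def)
  then have "arc_form \<alpha> E x = arc_form \<alpha> A x + (arc_form \<alpha> B x + arc_form \<alpha> (F \<union> F\<inverse>) x)"
    unfolding E using fins by (simp add: arc_form_Un)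
  also have "arc_form \<alpha> (F \<union> F\<inverse>) x = (\<Sum>(w, v)\<in>F. edge_weight \<alpha> (x w) (x v))"
    by (rule arc_form_symmetric_closure) (use finE disj in \<open>auto simp: F_def\<close>)
  also have "F = Sigma W (\<lambda>w. E `` {w} \<inter> P)" by (auto simp: F_def)
  also have "(\<Sum>(w, v)\<in>\<dots>. edge_weight \<alpha> (x w) (x v)) =
      (\<Sum>w\<in>W. \<Sum>v\<in>E `` {w} \<inter> P. edge_weight \<alpha> (x w) (x v))"
    using fin by (subst sum.Sigma) auto
  finally show ?thesis by (simp add: A_def B_def)
qed

lemma arc_form_mono:
  assumes "finite F" "E \<subseteq> F" and pos: "\<And>u v. (u, v) \<in> F \<Longrightarrow> x u > 0 \<and> x v > 0"
    and \<alpha>: "0 \<le> \<alpha>" "\<alpha> < 1"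
  shows "arc_form \<alpha> E x \<le> arc_form \<alpha> F x"
    and "arc_form \<alpha> E x = arc_form \<alpha> F x \<Longrightarrow> E = F"
proof -
  define g where "g = (\<lambda>(u, v). \<alpha> * (x u)\<^sup>2 + (1 - \<alpha>) * (x u * x v))"
  have g: "g e > 0" if "e \<in> F" for e
    using pos \<alpha> that by (cases e) (auto simp: g_def intro!: add_nonneg_pos)
  have diff: "arc_form \<alpha> F x = arc_form \<alpha> E x + sum g (F - E)"
    unfolding arc_form_def g_def[symmetric] using assms by (subst sum.subset_diff[of E F]) auto
  show "arc_form \<alpha> E x \<le> arc_form \<alpha> F x"
    unfolding diff using sum_nonneg[of "F - E" g] g by (meson DiffD1 le_add_same_cancel1 less_imp_le)
  assume "arc_form \<alpha> E x = arc_form \<alpha> F x"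
  with diff have "sum g (F - E) = 0" by simp
  moreover have "sum g (F - E) > 0" if "F - E \<noteq> {}"
    using sum_pos[of "F - E" g] that g assms(1) by blast
  ultimately show "E = F" using assms(2) by force
qed

section \<open>The extremal graph\<close>

text \<open>
  The path of the extremal graph is numbered outwards from its centre, alternating between the two
  sides: \<open>\<dots>, 4, 2, 0, 1, 3, \<dots>\<close>. This is the order in which the rearrangement places decreasing values.
\<close>

definition spine :: "nat \<Rightarrow> (nat \<times> nat) set" where
  "spine k = insert (0, 1) ((\<lambda>i. (i, i + 2)) ` {..<k - 1})"

text \<open>Vertices \<open>0..k\<close> form the path and the remaining \<open>m\<close> are the
  outside ones, complete to each other and joined to the consecutive path vertices 2, 0, 1. These
  three together with the outside vertices are the clique of \<open>B_graph\<close>, with 1 and 2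
  the ends of the deleted edge.\<close>

definition bag_graph :: "nat \<Rightarrow> nat \<Rightarrow> nat pair_pre_digraph" where
  "bag_graph k m = \<lparr> pverts = {..k + m},
     parcs = spine k \<union> (spine k)\<inverse> \<union> {(u, v). u \<in> {k<..k + m} \<and> v \<in> {k<..k + m} \<and> u \<noteq> v} \<union>
       {k<..k + m} \<times> {..<3} \<union> {..<3} \<times> {k<..k + m} \<rparr>"

lemma spine_bounds: "(i, j) \<in> spine k \<Longrightarrow> 2 \<le> k \<Longrightarrow> i < j \<and> i \<le> k \<and> j \<le> k"
  by (auto simp: spine_def)

lemma finite_spine [simp]: "finite (spine k)"
  by (simp add: spine_def)

lemma pverts_bag_graph [simp]: "pverts (bag_graph k m) = {..k + m}"
  by (simp add: bag_graph_def)

lemma pair_graph_bag_graph: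
  assumes k: "2 \<le> k"
  shows "pair_graph (bag_graph k m)"
proof
  have "parcs (bag_graph k m) \<subseteq> {..k + m} \<times> {..k + m}"
    using k by (auto simp: bag_graph_def dest: spine_bounds[OF _ k])
  then show "finite (parcs (bag_graph k m))" by (rule finite_subset) simp
  show "fst e \<in> pverts (bag_graph k m)" "snd e \<in> pverts (bag_graph k m)" "fst e \<noteq> snd e"
    if "e \<in> parcs (bag_graph k m)" for e
    using that k by (cases e; auto simp: bag_graph_def dest: spine_bounds[OF _ k])+
  show "symmetric (with_proj (bag_graph k m))"
    by (auto simp: symmetric_def bag_graph_def intro!: symI)
qed simp

lemma sum_spine: "k \<ge> 1 \<Longrightarrow> (\<Sum>(i, j)\<in>spine k. f i j) = f 0 1 + (\<Sum>i<k - 1. f i (i + 2))"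
  unfolding spine_def by (subst sum.insert) (auto simp: sum.reindex inj_on_def)

lemma arc_form_bag_graph:
  assumes k: "2 \<le> k"
  shows "arc_form \<alpha> (parcs (bag_graph k m)) y =
    edge_weight \<alpha> (y 0) (y 1) + (\<Sum>i<k - 1. edge_weight \<alpha> (y i) (y (i + 2))) +
    arc_form \<alpha> {(u, v). u \<in> {k<..k + m} \<and> v \<in> {k<..k + m} \<and> u \<noteq> v} y +
    (\<Sum>w\<in>{k<..k + m}. \<Sum>i<3. edge_weight \<alpha> (y w) (y i))"
proof -
  let ?E = "parcs (bag_graph k m)" and ?W = "{k<..k + m}"
  have sym: "sym ?E" by (auto simp: bag_graph_def intro!: symI)
  have sub: "?E \<subseteq> ({..k} \<union> ?W) \<times> ({..k} \<union> ?W)"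
    using k by (auto simp: bag_graph_def dest: spine_bounds[OF _ k])
  have disj: "spine k \<inter> (spine k)\<inverse> = {}"
    by (auto dest!: spine_bounds[OF _ k])
  have PP: "?E \<inter> {..k} \<times> {..k} = spine k \<union> (spine k)\<inverse>"
    using k by (auto simp: bag_graph_def dest: spine_bounds[OF _ k])
  have WW: "?E \<inter> ?W \<times> ?W = {(u, v). u \<in> ?W \<and> v \<in> ?W \<and> u \<noteq> v}"
    using k by (auto simp: bag_graph_def dest: spine_bounds[OF _ k])
  have WP: "?E `` {w} \<inter> {..k} = {..<3}" if "w \<in> ?W" for w
    using k that by (auto simp: bag_graph_def dest: spine_bounds[OF _ k])
  have "arc_form \<alpha> ?E y = arc_form \<alpha> (spine k \<union> (spine k)\<inverse>) y +
    arc_form \<alpha> {(u, v). u \<in> ?W \<and> v \<in> ?W \<and> u \<noteq> v} y +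
    (\<Sum>w\<in>?W. \<Sum>i\<in>?E `` {w} \<inter> {..k}. edge_weight \<alpha> (y w) (y i))"
    unfolding PP[symmetric] WW[symmetric] by (rule arc_form_split) (use sub sym in auto)
  also have "arc_form \<alpha> (spine k \<union> (spine k)\<inverse>) y =
      edge_weight \<alpha> (y 0) (y 1) + (\<Sum>i<k - 1. edge_weight \<alpha> (y i) (y (i + 2)))"
    using k disj by (subst arc_form_symmetric_closure) (simp_all add: sum_spine)
  finally show ?thesis by (simp add: WP)
qed

text \<open>In \<open>B_graph\<close> the deleted edge joins 0 and 1. The even side of the path,
  which has \<open>k div 2\<close> vertices beyond the centre, becomes the path attached at 0, and
  the odd side becomes the path attached at 1; thus 2 goes to 0, 1 stays, and the centre 0 becomes
  the clique vertex 2. New path vertices are numbered from \<open>p\<close> on one side and from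
  \<open>p + q - 1\<close> on the other, as \<open>attach_path\<close> does.\<close>

definition bag_relabel :: "nat \<Rightarrow> nat \<Rightarrow> nat \<Rightarrow> nat" where
  "bag_relabel k m i = (let p = m + 3; q = k div 2 in
     if i = 0 then 2 else if i = 1 then 1 else if i = 2 then 0
     else if i > k then i - k + 2
     else if even i then p + i div 2 - 2 else p + q + i div 2 - 2)"

lemma pair_image_union:
  "map_prod h h ` (F \<union> F\<inverse>) = map_prod h h ` F \<union> (map_prod h h ` F)\<inverse>"
  by (auto simp: image_iff)

lemma map_prod_off_diagonal:
  assumes "inj_on h W"
  shows "map_prod h h ` {(u, v). u \<in> W \<and> v \<in> W \<and> u \<noteq> v} =
    {(u, v). u \<in> h ` W \<and> v \<in> h ` W \<and> u \<noteq> v}"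
proof (intro equalityI subsetI)
  fix e assume "e \<in> {(u, v). u \<in> h ` W \<and> v \<in> h ` W \<and> u \<noteq> v}"
  then obtain u v where "e = map_prod h h (u, v)" "u \<in> W" "v \<in> W" "u \<noteq> v" by auto
  then show "e \<in> map_prod h h ` {(u, v). u \<in> W \<and> v \<in> W \<and> u \<noteq> v}" by blast
qed (use assms in \<open>auto dest: inj_onD\<close>)

lemma complete_minus_edge_arcs:
  fixes n :: nat
  assumes n: "3 \<le> n"
  shows "{(u, v). u < n \<and> v < n \<and> u \<noteq> v} - {(0, 1), (1, 0)} =
    {(2, 1), (1, 2), (2, 0), (0, 2)} \<union>
    {(u, v). u \<in> {3..<n} \<and> v \<in> {3..<n} \<and> u \<noteq> v} \<union>
    {3..<n} \<times> {..<3} \<union> {..<3} \<times> {3..<n}" (is "?K = ?K'")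
proof (rule Set.set_eqI)
  fix e :: "nat \<times> nat"
  obtain u v where e: "e = (u, v)" by (cases e)
  consider "3 \<le> u" | "u < 3" "3 \<le> v"
    | "u = 0 \<or> u = 1 \<or> u = 2" "v = 0 \<or> v = 1 \<or> v = 2" by linarith
  then show "e \<in> ?K \<longleftrightarrow> e \<in> ?K'"
  proof cases
    case 1
    then show ?thesis using n unfolding e by simp linarith
  next
    case 2
    then show ?thesis using n unfolding e by simp
  next
    case 3
    then show ?thesis using n unfolding e by (elim disjE) simp_all
  qed
qed

lemma path_arcs_eq:
  "{(x, y). \<exists>i. Suc i < n \<and> {x, y} = {w i, w (Suc i)}} =
    ((\<lambda>i. (w i, w (Suc i))) ` {..<n - 1}) \<union> ((\<lambda>i. (w i, w (Suc i))) ` {..<n - 1})\<inverse>"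
  by (auto simp: doubleton_eq_iff less_diff_conv)

lemma spine_even_odd:
  assumes "2 \<le> k"
  shows "spine k = insert (0, 1) (insert (0, 2)
    ((\<lambda>s. (2 * s + 2, 2 * s + 4)) ` {..<k div 2 - 1} \<union> (\<lambda>s. (2 * s + 1, 2 * s + 3)) ` {..<(k + 1) div 2 - 1}))"
proof -
  have "(\<lambda>i. (i, i + 2)) ` {..<k - 1} = insert (0, 2)
    ((\<lambda>s. (2 * s + 2, 2 * s + 4)) ` {..<k div 2 - 1} \<union> (\<lambda>s. (2 * s + 1, 2 * s + 3)) ` {..<(k + 1) div 2 - 1})"
    (is "?L = ?R")
  proof
    show "?L \<subseteq> ?R"
    proof
      fix e assume "e \<in> ?L"
      then obtain i where i: "i < k - 1" "e = (i, i + 2)" by auto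
      consider "i = 0" | s where "i = 2 * s + 2" | s where "i = 2 * s + 1"
        by (metis add_2_eq_Suc' evenE gr0_conv_Suc mult_Suc_right not_gr_zero oddE add.commute mult_0_right)
      then show "e \<in> ?R"
      proof cases
        case 1 then show ?thesis using i by simp
      next
        case 2
        then have "s < k div 2 - 1" using i by linarith
        then show ?thesis using i 2 by auto
      next
        case 3
        then have "s < (k + 1) div 2 - 1" using i by linarith
        then show ?thesis using i 3 by auto
      qed
    qed
    show "?R \<subseteq> ?L"
    proof
      fix e assume "e \<in> ?R"
      then consider "e = (0, 2)" | s where "s < k div 2 - 1" "e = (2 * s + 2, 2 * s + 4)"
        | s where "s < (k + 1) div 2 - 1" "e = (2 * s + 1, 2 * s + 3)" by auto
      then show "e \<in> ?L"
      proof cases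
        case 1 then show ?thesis using assms by (intro image_eqI[of _ _ 0]) auto
      next
        case 2 then show ?thesis by (intro image_eqI[of _ _ "2 * s + 2"]) auto
      next
        case 3 then show ?thesis by (intro image_eqI[of _ _ "2 * s + 1"]) auto
      qed
    qed
  qed
  then show ?thesis by (simp add: spine_def)
qed

lemma bag_graph_iso_B_graph:
  fixes k m :: nat
  assumes k: "2 \<le> k"
  defines "B \<equiv> B_graph (m + 3) (k div 2) ((k + 1) div 2)"
  shows "bij_betw (bag_relabel k m) {..k + m} (pverts B)"
    and "parcs B = map_prod (bag_relabel k m) (bag_relabel k m) ` parcs (bag_graph k m)"
proof -
  define q r where "q = k div 2" and "r = (k + 1) div 2"
  have qr: "q \<ge> 1" "r \<ge> 1" "q + r = k" "q \<le> r" "r \<le> q + 1" using k by (auto simp: q_def r_def)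
  let ?h = "bag_relabel k m" and ?W = "{k<..k + m}"
  have VB: "pverts B = {..<k + m + 1}"
    unfolding B_def using k by (subst pverts_B_graph) auto
  have h_small: "?h 0 = 2" "?h 1 = 1" "?h 2 = 0" "?h (Suc 0) = 1"
    by (simp_all add: bag_relabel_def)
  have h_even: "?h (2 * s + 2) = (if s = 0 then 0 else m + 3 + s - 1)" if "s < q" for s
    using that k by (auto simp: bag_relabel_def Let_def q_def)
  have h_odd: "?h (2 * s + 1) = (if s = 0 then 1 else m + 3 + q - 1 + s - 1)" if "s < r" for s
    using that k by (auto simp: bag_relabel_def Let_def q_def r_def)
  have h_W: "?h w = w - k + 2" if "w > k" for w
    using that k by (auto simp: bag_relabel_def Let_def)
  have imW: "?h ` ?W = {3..<m + 3}"
  proof -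
    have "?h ` ?W = (\<lambda>w. w - k + 2) ` ?W" by (intro image_cong) (auto simp: h_W)
    also have "\<dots> = {3..<m + 3}"
    proof (intro equalityI subsetI)
      fix x assume "x \<in> {3..<m + 3}"
      then show "x \<in> (\<lambda>w. w - k + 2) ` ?W" by (intro image_eqI[of _ _ "x + k - 2"]) auto
    qed auto
    finally show ?thesis .
  qed
  have "x \<in> ?h ` {..k + m}" if x: "x < k + m + 1" for x
  proof -
    have "\<exists>i\<le>k + m. x = ?h i"
    proof -
      consider "x \<le> 2" | "3 \<le> x" "x < m + 3" | "m + 3 \<le> x" "x < m + 2 + q"
        | "m + 2 + q \<le> x" "m + 3 \<le> x" "x < m + 1 + q + r" using x qr by linarith
      then show ?thesis
      proof cases
        case 1
        then have "x = 0 \<or> x = 1 \<or> x = 2" by linarith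
        then show ?thesis using h_small k by (metis add_leD1 le0 le_add1 le_trans one_le_numeral)
      next
        case 2
        then show ?thesis using h_W[of "x + k - 2"] by (intro exI[of _ "x + k - 2"]) auto
      next
        case 3
        define s where "s = x - (m + 2)"
        have "s < q" "0 < s" "x = m + 3 + s - 1" using 3 by (auto simp: s_def)
        then show ?thesis using h_even[of s] qr by (intro exI[of _ "2 * s + 2"]) auto
      next
        case 4
        define s where "s = x - (m + 1 + q)"
        have "s < r" "0 < s" "x = m + 3 + q - 1 + s - 1" using 4 qr by (auto simp: s_def)
        then show ?thesis using h_odd[of s] qr by (intro exI[of _ "2 * s + 1"]) auto
      qed
    qed
    then show ?thesis by auto
  qed
  moreover have "?h ` {..k + m} \<subseteq> {..<k + m + 1}"
    using k by (auto simp: bag_relabel_def Let_def) presburger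
  ultimately have surj: "?h ` {..k + m} = {..<k + m + 1}" by auto
  \<comment> \<open>Injectivity follows by counting, since source and image have the same
    size.\<close>
  have inj: "inj_on ?h {..k + m}" by (rule eq_card_imp_inj_on) (simp_all add: surj)
  show "bij_betw ?h {..k + m} (pverts B)" by (simp add: bij_betw_def VB surj inj)
  \<comment> \<open>These are the vertex sequences used by \<open>attach_path\<close>. The second
    starts later by \<open>q - 1\<close>, the number of vertices that the first path has
    added.\<close>
  define wl where "wl i = (if i = 0 then 0 else m + 3 + i - 1)" for i :: nat
  define wr where "wr i = (if i = 0 then 1 else m + 3 + q - 1 + i - 1)" for i :: nat
  define L where "L = (\<lambda>i. (wl i, wl (Suc i))) ` {..<q - 1}"
  define R where "R = (\<lambda>i. (wr i, wr (Suc i))) ` {..<r - 1}"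
  have spine_im: "map_prod ?h ?h ` spine k = insert (2, 1) (insert (2, 0) (L \<union> R))"
  proof -
    have "(\<lambda>s. (?h (2 * s + 2), ?h (2 * s + 4))) ` {..<q - 1} = L"
      unfolding L_def
    proof (intro image_cong refl)
      fix s assume "s \<in> {..<q - 1}"
      then show "(?h (2 * s + 2), ?h (2 * s + 4)) = (wl s, wl (Suc s))"
        using h_even[of s] h_even[of "Suc s"] by (simp add: wl_def numeral_eq_Suc)
    qed
    moreover have "(\<lambda>s. (?h (2 * s + 1), ?h (2 * s + 3))) ` {..<r - 1} = R"
      unfolding R_def
    proof (intro image_cong refl)
      fix s assume "s \<in> {..<r - 1}"
      then show "(?h (2 * s + 1), ?h (2 * s + 3)) = (wr s, wr (Suc s))"
        using h_odd[of s] h_odd[of "Suc s"] by (simp add: wr_def numeral_eq_Suc)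
    qed
    ultimately show ?thesis
      unfolding spine_even_odd[OF k, folded q_def r_def]
      by (simp add: image_Un image_image h_small)
  qed
  have WW_im: "map_prod ?h ?h ` {(u, v). u \<in> ?W \<and> v \<in> ?W \<and> u \<noteq> v} =
    {(u, v). u \<in> {3..<m + 3} \<and> v \<in> {3..<m + 3} \<and> u \<noteq> v}"
  proof -
    have "inj_on ?h ?W" using inj by (rule inj_on_subset) auto
    from map_prod_off_diagonal[OF this] show ?thesis unfolding imW .
  qed
  have three: "?h ` {..<3} = {..<3}"
    using h_small by (auto simp: numeral_3_eq_3 lessThan_Suc numeral_2_eq_2)
  have T: "map_prod ?h ?h ` parcs (bag_graph k m) =
    insert (2, 1) (insert (2, 0) (L \<union> R)) \<union> (insert (2, 1) (insert (2, 0) (L \<union> R)))\<inverse> \<union>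
    {(u, v). u \<in> {3..<m + 3} \<and> v \<in> {3..<m + 3} \<and> u \<noteq> v} \<union>
    {3..<m + 3} \<times> {..<3} \<union> {..<3} \<times> {3..<m + 3}"
    unfolding bag_graph_def pair_pre_digraph.simps image_Un[of _ "_ \<union> _"]
      pair_image_union spine_im WW_im map_prod_surj_on[OF imW three] map_prod_surj_on[OF three imW] ..
  have V1: "pverts (delete_edge (complete_graph (m + 3)) 0 1) = {..<m + 3}"
    by (simp add: delete_edge_def complete_graph_def)
  have V2: "pverts (attach_path (delete_edge (complete_graph (m + 3)) 0 1) 0 q) = {..<m + 3 + q - 1}"
    by (rule pverts_attach_path[OF V1]) (use qr in simp)
  have BK: "parcs B = ({(u, v). u < m + 3 \<and> v < m + 3 \<and> u \<noteq> v} - {(0, 1), (1, 0)}) \<union> (L \<union> L\<inverse>) \<union> (R \<union> R\<inverse>)"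
    unfolding B_def B_graph_def q_def[symmetric] r_def[symmetric] L_def R_def
      path_arcs_eq[symmetric] attach_path_def[of "attach_path _ _ _"] V2
    unfolding attach_path_def V1
    by (simp add: Let_def wl_def wr_def delete_edge_def complete_graph_def add_ac)
  have K: "{(u :: nat, v :: nat). u < m + 3 \<and> v < m + 3 \<and> u \<noteq> v} - {(0, 1), (1, 0)} =
    {(2, 1), (1, 2), (2, 0), (0, 2)} \<union>
    {(u, v). u \<in> {3..<m + 3} \<and> v \<in> {3..<m + 3} \<and> u \<noteq> v} \<union>
    {3..<m + 3} \<times> {..<3} \<union> {..<3} \<times> {3..<m + 3}"
    by (rule complete_minus_edge_arcs) simp
  show "parcs B = map_prod ?h ?h ` parcs (bag_graph k m)"
    unfolding BK K T by blast
qed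

lemma ex_decreasing_arrangement:
  fixes f :: "nat \<Rightarrow> real"
  shows "\<exists>\<tau>. bij_betw \<tau> {..k} {..k} \<and> (\<forall>i j. i \<le> j \<longrightarrow> j \<le> k \<longrightarrow> f (\<tau> j) \<le> f (\<tau> i))"
proof -
  define l where "l = sort_key (\<lambda>i. - f i) [0..<Suc k]"
  have len: "length l = Suc k" by (simp add: l_def)
  have set: "set l = {..k}" by (simp add: l_def atLeast0LessThan lessThan_Suc_atMost del: upt_Suc)
  have dist: "distinct l" by (simp add: l_def del: upt_Suc)
  have "bij_betw (\<lambda>i. l ! i) {..<Suc k} (set l)"
    by (rule bij_betw_nth[OF dist]) (simp_all add: len)
  moreover have "f (l ! j) \<le> f (l ! i)" if "i \<le> j" "j \<le> k" for i j
  proof -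
    have "sorted (map (\<lambda>i. - f i) l)" by (simp add: l_def del: upt_Suc)
    from sorted_nth_mono[OF this that(1)] that len show ?thesis by simp
  qed
  ultimately show ?thesis unfolding set lessThan_Suc_atMost by blast
qed

lemma window_of_card_3:
  fixes N :: "nat set"
  assumes "finite N" "N \<noteq> {}" "\<And>i j. i \<in> N \<Longrightarrow> j \<in> N \<Longrightarrow> j \<le> i + 2"
  shows "card N \<le> 3" and "card N = 3 \<Longrightarrow> \<exists>M. N = {M..M + 2}"
proof -
  have sub: "N \<subseteq> {Min N..Min N + 2}"
    using Min_le[OF assms(1)] assms(3)[OF Min_in[OF assms(1,2)]] by auto
  from card_mono[OF _ sub] show "card N \<le> 3" by simp
  assume "card N = 3"
  then have "N = {Min N..Min N + 2}" by (intro card_subset_eq sub) auto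
  then show "\<exists>M. N = {M..M + 2}" by blast
qed

lemma arc_form_cong:
  assumes "\<And>u v. (u, v) \<in> E \<Longrightarrow> x u = y u \<and> x v = y v"
  shows "arc_form \<alpha> E x = arc_form \<alpha> E y"
  unfolding arc_form_def by (intro sum.cong) (auto dest: assms)

section \<open>Comparison along a geodesic\<close>

text \<open>\<open>chord\<close> and \<open>detour\<close> keep what is needed of the distance: the
  path is induced, and the neighbours of any vertex on it lie within a window of three positions.
  One-sided bounds suffice because arcs are symmetric.\<close>

locale geodesic = pair_graph G for G :: "'a pair_pre_digraph" +
  fixes k m :: nat and p :: "nat \<Rightarrow> 'a"
  assumes k: "2 \<le> k"
    and p_inj: "inj_on p {..k}"
    and p_in: "p ` {..k} \<subseteq> pverts G"
    and step: "\<And>j. j < k \<Longrightarrow> (p j, p (Suc j)) \<in> parcs G"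
    and chord: "\<And>i j. i \<le> k \<Longrightarrow> j \<le> k \<Longrightarrow> (p i, p j) \<in> parcs G \<Longrightarrow> j \<le> Suc i"
    and detour: "\<And>i j w. i \<le> k \<Longrightarrow> j \<le> k \<Longrightarrow> (p i, w) \<in> parcs G \<Longrightarrow> (w, p j) \<in> parcs G \<Longrightarrow> j \<le> i + 2"
    and card_V: "card (pverts G) = Suc (k + m)"
begin

definition outside :: "'a set" where "outside = pverts G - p ` {..k}"

definition path_arcs :: "('a \<times> 'a) set" where "path_arcs = (\<lambda>j. (p j, p (Suc j))) ` {..<k}"

lemma p_eq_iff [simp]: "i \<le> k \<Longrightarrow> j \<le> k \<Longrightarrow> p i = p j \<longleftrightarrow> i = j"
  using p_inj by (auto simp: inj_on_def)

lemma finite_outside [simp]: "finite outside"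
  using pair_finite_verts by (simp add: outside_def)

lemma card_outside: "card outside = m"
  using card_Diff_subset[OF _ p_in] p_inj card_V by (simp add: outside_def card_image)

lemma V_split: "pverts G = p ` {..k} \<union> outside" "p ` {..k} \<inter> outside = {}"
  using p_in by (auto simp: outside_def)

lemma sym_arc: "(u, v) \<in> parcs G \<longleftrightarrow> (v, u) \<in> parcs G"
  using arcs_symmetric by blast

lemma path_arcs_antisym: "path_arcs \<inter> path_arcs\<inverse> = {}"
  by (auto simp: path_arcs_def)

lemma no_loop: "(u, u) \<notin> parcs G"
  using pair_no_loops[of "(u, u)"] by auto

lemma parcs_on_path: "parcs G \<inter> p ` {..k} \<times> p ` {..k} = path_arcs \<union> path_arcs\<inverse>"
proof (intro equalityI subsetI)
  fix e assume "e \<in> parcs G \<inter> p ` {..k} \<times> p ` {..k}"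
  then obtain i j where ij: "e = (p i, p j)" "i \<le> k" "j \<le> k" "(p i, p j) \<in> parcs G" by auto
  then have "i \<noteq> j" using no_loop by auto
  with ij chord[of i j] chord[of j i] sym_arc have "j = Suc i \<or> i = Suc j" by fastforce
  with ij show "e \<in> path_arcs \<union> path_arcs\<inverse>" by (auto simp: path_arcs_def)
next
  fix e assume "e \<in> path_arcs \<union> path_arcs\<inverse>"
  then obtain j where "j < k" "e = (p j, p (Suc j)) \<or> e = (p (Suc j), p j)" by (auto simp: path_arcs_def)
  with step[of j] sym_arc show "e \<in> parcs G \<inter> p ` {..k} \<times> p ` {..k}" by auto
qed

lemma arc_form_path: "arc_form \<alpha> (path_arcs \<union> path_arcs\<inverse>) x =
  (\<Sum>j<k. edge_weight \<alpha> (x (p j)) (x (p (Suc j))))"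
proof -
  have "inj_on (\<lambda>j. (p j, p (Suc j))) {..<k}" by (auto simp: inj_on_def)
  then show ?thesis
    by (subst arc_form_symmetric_closure[OF _ path_arcs_antisym])
      (simp_all add: path_arcs_def sum.reindex)
qed

text \<open>Reading the geodesic backwards turns a bound on the left tail into one on the right
  tail.\<close>

lemma reversed: "geodesic G k m (\<lambda>j. p (k - j))"
proof unfold_locales
  show "inj_on (\<lambda>j. p (k - j)) {..k}" by (auto simp: inj_on_def)
  show "(\<lambda>j. p (k - j)) ` {..k} \<subseteq> pverts G" using p_in by auto
  show "(p (k - j), p (k - Suc j)) \<in> parcs G" if "j < k" for j
    using step[of "k - Suc j"] that sym_arc by (simp add: Suc_diff_Suc)
  show "j \<le> Suc i" if "i \<le> k" "j \<le> k" "(p (k - i), p (k - j)) \<in> parcs G" for i j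
    using chord[of "k - j" "k - i"] that sym_arc by auto
  show "j \<le> i + 2" if "i \<le> k" "j \<le> k" "(p (k - i), w) \<in> parcs G" "(w, p (k - j)) \<in> parcs G" for i j w
    using detour[of "k - j" "k - i" w] that sym_arc by auto
qed (use k card_V in auto)

end

text \<open>\<open>\<tau> i\<close> is the position on the geodesic of the value of rank
  \<open>i\<close>, the largest having rank 0; \<open>\<beta>\<close> numbers the outside vertices
  as in \<open>bag_graph\<close>.\<close>

locale sorted_geodesic = geodesic +
  fixes \<alpha> :: real and x :: "'a \<Rightarrow> real" and \<tau> :: "nat \<Rightarrow> nat" and \<beta> :: "nat \<Rightarrow> 'a"
  assumes \<alpha>: "0 \<le> \<alpha>" "\<alpha> < 1"
    and x_pos: "\<And>u. u \<in> pverts G \<Longrightarrow> x u > 0"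
    and \<tau>: "bij_betw \<tau> {..k} {..k}"
    and decreasing: "\<And>i j. i \<le> j \<Longrightarrow> j \<le> k \<Longrightarrow> x (p (\<tau> j)) \<le> x (p (\<tau> i))"
    and \<beta>: "bij_betw \<beta> {k<..k + m} outside"
begin

text \<open>The zero values beyond \<open>k\<close> supply the dummy entry that closes the path to a
  cycle, and give \<open>a 3\<close> a meaning when \<open>k = 2\<close>.\<close>

definition a :: "nat \<Rightarrow> real" where "a i = (if i \<le> k then x (p (\<tau> i)) else 0)"

definition y :: "nat \<Rightarrow> real" where "y i = (if i \<le> k then a i else x (\<beta> i))"

lemma \<tau>_le: "i \<le> k \<Longrightarrow> \<tau> i \<le> k"
  using \<tau> by (auto simp: bij_betw_def)

lemma a_pos: "i \<le> k \<Longrightarrow> a i > 0"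
  using x_pos p_in \<tau>_le by (auto simp: a_def)

lemma a_nonneg: "a i \<ge> 0"
  using a_pos[of i] by (cases "i \<le> k") (auto simp: a_def)

lemma antimono_a: "antimono a"
proof (rule antimonoI)
  fix i j :: nat
  assume "i \<le> j"
  then show "a j \<le> a i"
    using decreasing[of i j] a_nonneg[of i] by (cases "j \<le> k") (auto simp: a_def)
qed

lemma \<beta>_in: "i \<in> {k<..k + m} \<Longrightarrow> \<beta> i \<in> outside"
  using \<beta> by (auto simp: bij_betw_def)

lemma y_pos: "i \<le> k + m \<Longrightarrow> y i > 0"
  using a_pos \<beta>_in[of i] x_pos by (auto simp: y_def V_split)

lemma sum_y_squares: "(\<Sum>i\<le>k + m. (y i)\<^sup>2) = (\<Sum>u\<in>pverts G. (x u)\<^sup>2)"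
proof -
  have "bij_betw (p \<circ> \<tau>) {..k} (p ` {..k})"
    using \<tau> p_inj by (intro bij_betw_trans[OF \<tau>]) (simp add: bij_betw_def)
  from sum.reindex_bij_betw[OF this, of "\<lambda>u. (x u)\<^sup>2"]
  have P: "(\<Sum>i\<le>k. (y i)\<^sup>2) = (\<Sum>u\<in>p ` {..k}. (x u)\<^sup>2)"
    by (simp add: y_def a_def)
  from sum.reindex_bij_betw[OF \<beta>, of "\<lambda>u. (x u)\<^sup>2"]
  have W: "(\<Sum>i\<in>{k<..k + m}. (y i)\<^sup>2) = (\<Sum>u\<in>outside. (x u)\<^sup>2)"
    by (simp add: y_def)
  have "{..k + m} = {..k} \<union> {k<..k + m}" by auto
  then have "(\<Sum>i\<le>k + m. (y i)\<^sup>2) = (\<Sum>i\<le>k. (y i)\<^sup>2) + (\<Sum>i\<in>{k<..k + m}. (y i)\<^sup>2)"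
    by (simp add: sum.union_disjoint disjoint_iff)
  also have "\<dots> = (\<Sum>u\<in>pverts G. (x u)\<^sup>2)"
    unfolding P W V_split(1) using V_split(2) by (subst sum.union_disjoint) auto
  finally show ?thesis .
qed

text \<open>Ranks, not positions, are recorded: the best possible contact set is then
  \<open>{..<3}\<close>, whereas the window condition is about its image under
  \<open>\<tau>\<close>.\<close>

definition contacts :: "'a \<Rightarrow> nat set" where
  "contacts w = {i. i \<le> k \<and> (w, p (\<tau> i)) \<in> parcs G}"

lemma contacts_image: "\<tau> ` contacts w = {j. j \<le> k \<and> (w, p j) \<in> parcs G}"
  using \<tau> by (auto simp: contacts_def bij_betw_def image_iff)

lemma finite_contacts: "finite (contacts w)"
  by (rule finite_subset[of _ "{..k}"]) (auto simp: contacts_def)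

lemma card_contacts_image: "card (\<tau> ` contacts w) = card (contacts w)"
proof (rule card_image)
  show "inj_on \<tau> (contacts w)"
    using \<tau> by (auto simp: contacts_def bij_betw_def inj_on_def)
qed

lemma contacts_window:
  assumes "i \<in> \<tau> ` contacts w" "j \<in> \<tau> ` contacts w"
  shows "j \<le> i + 2"
  using assms detour[of i j w] sym_arc unfolding contacts_image by auto

lemma card_contacts: "card (contacts w) \<le> 3"
proof (cases "contacts w = {}")
  case False
  then show ?thesis
    using window_of_card_3(1)[of "\<tau> ` contacts w"] finite_contacts contacts_window
    by (simp add: card_contacts_image)
qed simp

lemma sum_contacts:
  "(\<Sum>v\<in>parcs G `` {w} \<inter> p ` {..k}. edge_weight \<alpha> (x w) (x v)) =
   (\<Sum>i\<in>contacts w. edge_weight \<alpha> (x w) (a i))"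
proof -
  have "parcs G `` {w} \<inter> p ` {..k} = p ` \<tau> ` contacts w"
    unfolding contacts_image by auto
  then have "parcs G `` {w} \<inter> p ` {..k} = (p \<circ> \<tau>) ` contacts w"
    by (simp only: image_comp)
  moreover have "inj_on (p \<circ> \<tau>) (contacts w)"
    using \<tau> \<tau>_le by (auto simp: inj_on_def contacts_def bij_betw_def)
  ultimately have "(\<Sum>v\<in>parcs G `` {w} \<inter> p ` {..k}. edge_weight \<alpha> (x w) (x v)) =
      (\<Sum>i\<in>contacts w. edge_weight \<alpha> (x w) (x ((p \<circ> \<tau>) i)))"
    by (simp only: sum.reindex) (simp only: o_def)
  also have "\<dots> = (\<Sum>i\<in>contacts w. edge_weight \<alpha> (x w) (a i))"
    by (intro sum.cong) (auto simp: contacts_def a_def)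
  finally show ?thesis .
qed

lemma antimono_weight:
  assumes "w \<in> outside"
  shows "antimono (\<lambda>i. edge_weight \<alpha> (x w) (a i))"
  using assms \<alpha> x_pos[of w] antimonoD[OF antimono_a] a_nonneg
  by (intro antimonoI edge_weight_mono) (auto simp: V_split less_imp_le)

lemma sum_contacts_le:
  assumes "w \<in> outside"
  shows "(\<Sum>i\<in>contacts w. edge_weight \<alpha> (x w) (a i)) \<le> (\<Sum>i<3. edge_weight \<alpha> (x w) (a i))"
proof (rule top_three_le(1)[OF finite_contacts card_contacts antimono_weight[OF assms]])
  show "edge_weight \<alpha> (x w) (a 2) \<ge> 0"
    using assms \<alpha> x_pos[of w] a_nonneg by (intro edge_weight_nonneg) (auto simp: V_split less_imp_le)
qed

lemma path_part_le:
  "(\<Sum>j<k. edge_weight \<alpha> (x (p j)) (x (p (Suc j)))) \<le>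
    edge_weight \<alpha> (y 0) (y 1) + (\<Sum>i<k - 1. edge_weight \<alpha> (y i) (y (i + 2)))"
proof -
  \<comment> \<open>The inverse of \<open>\<tau>\<close> sends a position to its rank, so the path
    of \<open>G\<close> becomes an arrangement of the decreasing sequence \<open>a\<close>.\<close>
  define \<sigma> where "\<sigma> = the_inv_into {..k} \<tau>"
  have \<sigma>: "bij_betw \<sigma> {..k} {..k}" unfolding \<sigma>_def by (rule bij_betw_the_inv_into[OF \<tau>])
  have a\<sigma>: "a (\<sigma> j) = x (p j)" if "j \<le> k" for j
  proof -
    have "\<sigma> j \<le> k" using \<sigma> that by (auto simp: bij_betw_def)
    moreover have "\<tau> (\<sigma> j) = j"
      unfolding \<sigma>_def using \<tau> that by (intro f_the_inv_into_f_bij_betw[OF \<tau>]) auto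
    ultimately show ?thesis by (simp add: a_def)
  qed
  have "(\<Sum>j<k. edge_weight \<alpha> (x (p j)) (x (p (Suc j)))) =
    (\<Sum>j<k. edge_weight \<alpha> (a (\<sigma> j)) (a (\<sigma> (Suc j))))"
    by (intro sum.cong) (auto simp: a\<sigma>)
  also have "\<dots> \<le> edge_weight \<alpha> (a 0) (a 1) + (\<Sum>i<k - 1. edge_weight \<alpha> (a i) (a (i + 2)))"
    by (rule path_weight_le[OF antimono_a a_nonneg _ \<sigma> _ \<alpha>]) (use k in \<open>auto simp: a_def\<close>)
  also have "\<dots> = edge_weight \<alpha> (y 0) (y 1) + (\<Sum>i<k - 1. edge_weight \<alpha> (y i) (y (i + 2)))"
    using k by (auto simp: y_def intro!: sum.cong)
  finally show ?thesis .
qed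

definition outside_pairs :: "('a \<times> 'a) set" where
  "outside_pairs = {(u, v). u \<in> outside \<and> v \<in> outside \<and> u \<noteq> v}"

lemma outside_part_eq:
  "arc_form \<alpha> {(u, v). u \<in> {k<..k + m} \<and> v \<in> {k<..k + m} \<and> u \<noteq> v} y = arc_form \<alpha> outside_pairs x"
proof -
  let ?D = "{(u, v). u \<in> {k<..k + m} \<and> v \<in> {k<..k + m} \<and> u \<noteq> v}"
  have inj: "inj_on \<beta> {k<..k + m}" and im: "\<beta> ` {k<..k + m} = outside"
    using \<beta> by (auto simp: bij_betw_def)
  have "outside_pairs = map_prod \<beta> \<beta> ` ?D"
    unfolding map_prod_off_diagonal[OF inj] im outside_pairs_def ..
  moreover have "?D \<subseteq> {k<..k + m} \<times> {k<..k + m}" by auto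
  ultimately have "arc_form \<alpha> outside_pairs x = arc_form \<alpha> ?D (x \<circ> \<beta>)"
    by (simp only: arc_form_reindex[OF inj])
  also have "\<dots> = arc_form \<alpha> ?D y" by (rule arc_form_cong) (auto simp: y_def)
  finally show ?thesis by simp
qed

lemma outside_arcs_le:
  shows "arc_form \<alpha> (parcs G \<inter> outside \<times> outside) x \<le> arc_form \<alpha> outside_pairs x"
    and "arc_form \<alpha> (parcs G \<inter> outside \<times> outside) x = arc_form \<alpha> outside_pairs x \<Longrightarrow>
      parcs G \<inter> outside \<times> outside = outside_pairs"
proof -
  have fin: "finite outside_pairs"
    by (rule finite_subset[of _ "outside \<times> outside"]) (auto simp: outside_pairs_def)
  have sub: "parcs G \<inter> outside \<times> outside \<subseteq> outside_pairs"
    using no_loop by (auto simp: outside_pairs_def)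
  have pos: "x u > 0 \<and> x v > 0" if "(u, v) \<in> outside_pairs" for u v
    using that x_pos by (auto simp: outside_pairs_def V_split)
  show "arc_form \<alpha> (parcs G \<inter> outside \<times> outside) x \<le> arc_form \<alpha> outside_pairs x"
    by (rule arc_form_mono(1)[OF fin sub pos \<alpha>])
  show "parcs G \<inter> outside \<times> outside = outside_pairs"
    if "arc_form \<alpha> (parcs G \<inter> outside \<times> outside) x = arc_form \<alpha> outside_pairs x"
    by (rule arc_form_mono(2)[OF fin sub pos \<alpha> that])
qed

lemma arc_form_G: "arc_form \<alpha> (parcs G) x = (\<Sum>j<k. edge_weight \<alpha> (x (p j)) (x (p (Suc j)))) +
  arc_form \<alpha> (parcs G \<inter> outside \<times> outside) x +
  (\<Sum>w\<in>outside. \<Sum>i\<in>contacts w. edge_weight \<alpha> (x w) (a i))"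
proof -
  have "sym (parcs G)" using sym_arc by (auto intro!: symI)
  moreover have "parcs G \<subseteq> (p ` {..k} \<union> outside) \<times> (p ` {..k} \<union> outside)"
    using in_arcsD1 in_arcsD2 by (auto simp: outside_def)
  ultimately show ?thesis
    using arc_form_split[of "p ` {..k}" outside "parcs G" \<alpha> x] V_split(2)
    by (simp add: parcs_on_path arc_form_path sum_contacts)
qed

lemma arc_form_bag: "arc_form \<alpha> (parcs (bag_graph k m)) y =
  edge_weight \<alpha> (y 0) (y 1) + (\<Sum>i<k - 1. edge_weight \<alpha> (y i) (y (i + 2))) +
  arc_form \<alpha> outside_pairs x + (\<Sum>w\<in>outside. \<Sum>i<3. edge_weight \<alpha> (x w) (a i))"
proof -
  have "(\<Sum>w\<in>{k<..k + m}. \<Sum>i<3. edge_weight \<alpha> (y w) (y i)) =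
    (\<Sum>w\<in>{k<..k + m}. \<Sum>i<3. edge_weight \<alpha> (x (\<beta> w)) (a i))"
    using k by (intro sum.cong) (auto simp: y_def)
  also have "\<dots> = (\<Sum>w\<in>outside. \<Sum>i<3. edge_weight \<alpha> (x w) (a i))"
    by (rule sum.reindex_bij_betw[OF \<beta>])
  finally show ?thesis unfolding arc_form_bag_graph[OF k] outside_part_eq by simp
qed

lemma arc_form_le: "arc_form \<alpha> (parcs G) x \<le> arc_form \<alpha> (parcs (bag_graph k m)) y"
  unfolding arc_form_G arc_form_bag
  by (intro add_mono path_part_le outside_arcs_le sum_mono sum_contacts_le)

text \<open>Path part, outside part and cross part are bounded separately, so equality of the totals
  is equality in each. In the outside part it forces all arcs to be present; in the cross part it
  passes down to every single outside vertex.\<close>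

lemma arc_form_equality:
  assumes eq: "arc_form \<alpha> (parcs G) x = arc_form \<alpha> (parcs (bag_graph k m)) y"
  shows "parcs G \<inter> outside \<times> outside = outside_pairs"
    and "w \<in> outside \<Longrightarrow> a 3 < a 2 \<Longrightarrow> contacts w = {..<3}"
proof -
  let ?c = "\<lambda>w. \<Sum>i\<in>contacts w. edge_weight \<alpha> (x w) (a i)"
  let ?t = "\<lambda>w. \<Sum>i<3. edge_weight \<alpha> (x w) (a i)"
  have cross: "sum ?c outside \<le> sum ?t outside" by (intro sum_mono sum_contacts_le)
  note parts = path_part_le outside_arcs_le(1) cross eq[unfolded arc_form_G arc_form_bag]
  have "arc_form \<alpha> (parcs G \<inter> outside \<times> outside) x = arc_form \<alpha> outside_pairs x"
    using parts by linarith
  then show "parcs G \<inter> outside \<times> outside = outside_pairs" by (rule outside_arcs_le(2))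
  have "sum ?c outside = sum ?t outside" using parts by linarith
  then have each: "?c w = ?t w" if "w \<in> outside" for w
    by (rule sum_mono_inv) (use that in \<open>auto intro: sum_contacts_le\<close>)
  assume w: "w \<in> outside" and strict: "a 3 < a 2"
  have xw: "x w > 0" using w x_pos by (simp add: V_split)
  show "contacts w = {..<3}"
  proof (rule top_three_le(2)[OF finite_contacts card_contacts antimono_weight[OF w] _ each[OF w]])
    show "edge_weight \<alpha> (x w) (a 3) < edge_weight \<alpha> (x w) (a 2)"
      by (rule edge_weight_strict_mono[OF \<alpha> xw a_nonneg strict])
    show "0 < edge_weight \<alpha> (x w) (a 2)" by (rule edge_weight_pos[OF \<alpha> xw a_pos[OF k]])
    then show "0 \<le> edge_weight \<alpha> (x w) (a 2)" by simp
  qed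
qed

end

section \<open>The equality case\<close>

text \<open>The right-hand side is a discrete Wronskian, which is the same at every index.\<close>

lemma wronskian_const:
  fixes X Y :: "nat \<Rightarrow> real"
  assumes "c \<noteq> 0"
    and "\<And>s. 1 \<le> s \<Longrightarrow> s \<le> n \<Longrightarrow> \<delta> s * X s = c * (X (s - 1) + X (s + 1))"
    and "\<And>s. 1 \<le> s \<Longrightarrow> s \<le> n \<Longrightarrow> \<delta> s * Y s = c * (Y (s - 1) + Y (s + 1))"
  shows "X 0 * Y 1 - X 1 * Y 0 = X n * Y (n + 1) - X (n + 1) * Y n"
  using assms(2,3)
proof (induction n)
  case (Suc n)
  have A: "c * (X n + X (Suc n + 1)) = \<delta> (Suc n) * X (Suc n)"
    and B: "c * (Y n + Y (Suc n + 1)) = \<delta> (Suc n) * Y (Suc n)"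
    using Suc.prems(1)[of "Suc n"] Suc.prems(2)[of "Suc n"] by simp_all
  have "c * (X n + X (Suc n + 1)) * Y (Suc n) = c * (Y n + Y (Suc n + 1)) * X (Suc n)"
    unfolding A B by (simp only: mult_ac)
  then have "c * ((X n + X (Suc n + 1)) * Y (Suc n)) = c * ((Y n + Y (Suc n + 1)) * X (Suc n))"
    by (simp only: mult.assoc)
  then have "(X n + X (Suc n + 1)) * Y (Suc n) = (Y n + Y (Suc n + 1)) * X (Suc n)"
    using assms(1) by simp
  then have "X n * Y (n + 1) - X (n + 1) * Y n = X (Suc n) * Y (Suc n + 1) - X (Suc n + 1) * Y (Suc n)"
    by (simp add: algebra_simps)
  with Suc show ?case by simp
qed simp

text \<open>That the same \<open>\<rho>\<close> occurs in \<open>x_eigen\<close> and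
  \<open>y_eigen\<close> expresses the equality of the two spectral radii; it lets values on
  \<open>G\<close> and on the extremal graph be compared through one recurrence.\<close>

locale extremal_geodesic = sorted_geodesic +
  fixes \<rho> :: real
  assumes form_eq: "arc_form \<alpha> (parcs G) x = arc_form \<alpha> (parcs (bag_graph k m)) y"
    and x_eigen: "\<And>u. u \<in> pverts G \<Longrightarrow>
      (\<Sum>v\<in>parcs G `` {u}. \<alpha> * x u + (1 - \<alpha>) * x v) = \<rho> * x u"
    and y_eigen: "\<And>i. i \<le> k + m \<Longrightarrow>
      (\<Sum>j\<in>parcs (bag_graph k m) `` {i}. \<alpha> * y i + (1 - \<alpha>) * y j) = \<rho> * y i"
    and m: "1 \<le> m"
begin

lemma Image_bag_graph:
  assumes "i \<le> k"
  shows "parcs (bag_graph k m) `` {i} = {j. (i, j) \<in> spine k \<or> (j, i) \<in> spine k} \<union>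
    (if i < 3 then {k<..k + m} else {})"
  using assms by (auto simp: bag_graph_def)

lemma spine_iff: "(i, j) \<in> spine k \<longleftrightarrow> i = 0 \<and> j = 1 \<or> j = i + 2 \<and> j \<le> k"
  using k by (auto simp: spine_def image_iff)

text \<open>If the two values agreed, the eigenvalue equations at 2 and 3 in the extremal graph
  would have equal sums. But vertex 2 has neighbours 0, 4 and all outside vertices, vertex 3 only 1
  and 5, and the values at 0 and 4 dominate those at 1 and 5; the outside vertices make the first
  sum strictly larger.\<close>

lemma a3_less_a2: "a 3 < a 2"
proof (cases "k = 2")
  case True
  then have "a 3 = 0" unfolding a_def by simp
  then show ?thesis using a_pos[OF k] by simp
next
  case False
  with k have k3: "3 \<le> k" by simp
  show ?thesis
  proof (rule ccontr)
    assume "\<not> a 3 < a 2"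
    with antimonoD[OF antimono_a, of 2 3] have eq: "a 3 = a 2" by simp
    let ?\<phi> = "\<lambda>j. \<alpha> * a 2 + (1 - \<alpha>) * y j"
    have pos: "?\<phi> j > 0" if "j \<le> k + m" for j
      using \<alpha> a_nonneg y_pos[OF that] by (intro add_nonneg_pos mult_nonneg_nonneg mult_pos_pos) auto
    have mono: "?\<phi> j \<le> ?\<phi> i" if "i \<le> j" "j \<le> k" for i j
      using \<alpha> antimonoD[OF antimono_a that(1)] that
      by (intro add_left_mono mult_left_mono) (auto simp: y_def)
    have N2: "parcs (bag_graph k m) `` {2} = {0} \<union> (if 4 \<le> k then {4} else {}) \<union> {k<..k + m}"
      using k by (subst Image_bag_graph) (auto simp: spine_iff)
    have N3: "parcs (bag_graph k m) `` {3} = {1} \<union> (if 5 \<le> k then {5} else {})"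
      using k3 by (subst Image_bag_graph) (auto simp: spine_iff)
    have "(\<Sum>j\<in>parcs (bag_graph k m) `` {2}. ?\<phi> j) = \<rho> * a 2"
      using y_eigen[of 2] k by (simp add: y_def)
    moreover have "(\<Sum>j\<in>parcs (bag_graph k m) `` {3}. ?\<phi> j) = \<rho> * a 2"
      using y_eigen[of 3] k3 eq by (simp add: y_def)
    moreover have "(\<Sum>j\<in>parcs (bag_graph k m) `` {2}. ?\<phi> j) =
      ?\<phi> 0 + (if 4 \<le> k then ?\<phi> 4 else 0) + (\<Sum>j\<in>{k<..k + m}. ?\<phi> j)"
      unfolding N2 by (subst sum.union_disjoint) auto
    moreover have "(\<Sum>j\<in>parcs (bag_graph k m) `` {3}. ?\<phi> j) = ?\<phi> 1 + (if 5 \<le> k then ?\<phi> 5 else 0)"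
      unfolding N3 by auto
    moreover have "(\<Sum>j\<in>{k<..k + m}. ?\<phi> j) > 0"
      using m pos by (intro sum_pos) auto
    moreover have "?\<phi> 1 \<le> ?\<phi> 0" using k by (intro mono) auto
    \<comment> \<open>Neighbour 5 exists only if neighbour 4 does.\<close>
    moreover have "(if 5 \<le> k then ?\<phi> 5 else 0) \<le> (if 4 \<le> k then ?\<phi> 4 else 0)"
      using mono[of 4 5] pos[of 4] by auto
    ultimately show False by linarith
  qed
qed

lemma contacts_eq: "w \<in> outside \<Longrightarrow> contacts w = {..<3}"
  using arc_form_equality(2)[OF form_eq _ a3_less_a2] .

lemma outside_complete: "parcs G \<inter> outside \<times> outside = outside_pairs"
  by (rule arc_form_equality(1)[OF form_eq])

text \<open>All outside vertices have the contact ranks \<open>{..<3}\<close>, so one of them, which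
  exists as \<open>1 \<le> m\<close>, shows that the positions of these ranks are three numbers
  within a window of three.\<close>

lemma ex_window: "\<exists>M. M + 2 \<le> k \<and> \<tau> ` {..<3} = {M..M + 2}"
proof -
  have "outside \<noteq> {}" using card_outside m by auto
  then obtain w where "w \<in> outside" by blast
  note c = contacts_eq[OF this]
  have "card (\<tau> ` {..<3}) = 3" using card_contacts_image[of w] by (simp add: c)
  moreover have "j \<le> i + 2" if "i \<in> \<tau> ` {..<3}" "j \<in> \<tau> ` {..<3}" for i j
    using contacts_window[of i w j] that by (simp add: c)
  ultimately have "\<exists>M. \<tau> ` {..<3} = {M..M + 2}"
    by (intro window_of_card_3(2)) auto
  then obtain M where M: "\<tau> ` {..<3} = {M..M + 2}" ..
  have "M + 2 \<in> \<tau> ` {..<3}" unfolding M by simp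
  then obtain i where "M + 2 = \<tau> i" "i < 3" by (elim imageE) simp
  then have "M + 2 \<le> k" using \<tau>_le[of i] k by simp
  with M show ?thesis by blast
qed

lemma outside_neighbours:
  assumes M: "\<tau> ` {..<3} = {M..M + 2}" and "w \<in> outside" "j \<le> k"
  shows "(w, p j) \<in> parcs G \<longleftrightarrow> M \<le> j \<and> j \<le> M + 2"
proof -
  have "j \<in> \<tau> ` contacts w \<longleftrightarrow> M \<le> j \<and> j \<le> M + 2"
    unfolding contacts_eq[OF assms(2)] M by simp
  then show ?thesis unfolding contacts_image using assms(3) by simp
qed

lemma Image_path:
  assumes M: "\<tau> ` {..<3} = {M..M + 2}" and "Suc j \<le> k"
  shows "parcs G `` {p j} = {p (Suc j)} \<union> (if 0 < j then {p (j - 1)} else {}) \<union>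
    (if M \<le> j \<and> j \<le> M + 2 then outside else {})" (is "_ = ?R")
proof (intro equalityI subsetI)
  fix v assume "v \<in> parcs G `` {p j}"
  then have v: "(p j, v) \<in> parcs G" by simp
  then have "v \<in> p ` {..k} \<or> v \<in> outside" using in_arcsD2 V_split by blast
  then show "v \<in> ?R"
  proof
    assume "v \<in> p ` {..k}"
    then obtain i where i: "v = p i" "i \<le> k" by auto
    with v chord[of j i] chord[of i j] sym_arc assms no_loop[of "p j"]
    have "i \<le> Suc j" "j \<le> Suc i" "i \<noteq> j" by auto
    then have "i = Suc j \<or> 0 < j \<and> i = j - 1" by linarith
    then show ?thesis using i by auto
  next
    assume w: "v \<in> outside"
    with v outside_neighbours[OF M w, of j] sym_arc assms have "M \<le> j \<and> j \<le> M + 2" by auto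
    with w show ?thesis by simp
  qed
next
  fix v assume "v \<in> ?R"
  then consider "v = p (Suc j)" | "0 < j" "v = p (j - 1)" | "v \<in> outside" "M \<le> j" "j \<le> M + 2"
    by (auto split: if_splits)
  then show "v \<in> parcs G `` {p j}"
  proof cases
    case 1 then show ?thesis using step[of j] assms by simp
  next
    case 2 then show ?thesis using step[of "j - 1"] assms sym_arc by simp
  next
    case 3 then show ?thesis using outside_neighbours[OF M, of v j] sym_arc assms by simp
  qed
qed

text \<open>
  Were the left tail of the path shorter than the shorter tail of the extremal graph, the two
  eigenvectors restricted to these tails would solve the same recurrence, and comparing Wronskians
  at both ends of the left tail puts a value below \<open>a 2\<close> among the three largest.
\<close>

lemma centre_ge:
  assumes M: "\<tau> ` {..<3} = {M..M + 2}" and Mk: "M + 2 \<le> k"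
  shows "k div 2 \<le> Suc M"
proof (rule ccontr)
  assume "\<not> k div 2 \<le> Suc M"
  then have short: "Suc M < k div 2" by simp
  \<comment> \<open>The middle of the window, and also the number of positions \<open>0..M\<close>
    up to its left end.\<close>
  define n where "n = Suc M"
  define S where "S = (\<Sum>w\<in>outside. x w)"
  \<comment> \<open>\<open>X\<close> runs from the middle of the window to the end
    \<open>p 0\<close>. Adding \<open>S\<close> at index 0 merges the outside vertices, which only
    the vertex at index 1 sees, with its path neighbour. The value at \<open>n + 1\<close> is
    fictitious: \<open>p 0\<close> lacks a second path neighbour, and (1 - \<alpha>) times this
    value equals -\<alpha> times \<open>x (p 0)\<close>, which corrects the degree in
    \<open>\<delta>\<close>.\<close>
  define X where "X s = (if s = 0 then x (p n) + S else if s \<le> n then x (p (n - s))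
    else - (\<alpha> / (1 - \<alpha>)) * x (p 0))" for s
  define Y where "Y s = (if s = 0 then a 0 + S else a (2 * s))" for s
  \<comment> \<open>The degree is \<open>m + 2\<close> at the left end of the window and 2 further
    out, the same on both tails.\<close>
  define \<delta> where "\<delta> s = \<rho> - \<alpha> * (if s = 1 then real m + 2 else 2)" for s :: nat
  have pin: "p j \<in> pverts G" if "j \<le> k" for j using p_in that by auto
  have S0: "S \<ge> 0" unfolding S_def using x_pos V_split by (intro sum_nonneg) (auto simp: less_imp_le)
  have not_out: "p j \<notin> outside" if "j \<le> k" for j using that by (auto simp: outside_def)
  have Xeq: "\<delta> s * X s = (1 - \<alpha>) * (X (s - 1) + X (s + 1))" if s: "1 \<le> s" "s \<le> n" for s
  proof -
    define j where "j = n - s"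
    have j: "Suc j \<le> k" "j \<le> M" "j < n" "s = n - j" using s Mk by (auto simp: j_def n_def)
    have "\<rho> * x (p j) = (\<Sum>v\<in>parcs G `` {p j}. \<alpha> * x (p j) + (1 - \<alpha>) * x v)"
      using x_eigen[of "p j"] pin[of j] j by simp
    also have "\<dots> = (\<alpha> * x (p j) + (1 - \<alpha>) * x (p (Suc j))) +
        (if 0 < j then \<alpha> * x (p j) + (1 - \<alpha>) * x (p (j - 1)) else 0) +
        (if j = M then m * (\<alpha> * x (p j)) + (1 - \<alpha>) * S else 0)"
      unfolding Image_path[OF M j(1)]
      using j Mk not_out by (subst sum.union_disjoint)
        (auto simp: S_def sum.distrib card_outside sum_distrib_left)
    finally have eq: "\<rho> * x (p j) = \<dots>" .
    have Xs: "X s = x (p j)" using s by (simp add: X_def j_def)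
    have Xprev: "X (s - 1) = x (p (Suc j)) + (if j = M then S else 0)"
      using s by (auto simp: X_def j_def n_def Suc_diff_le)
    have Xnext: "(1 - \<alpha>) * X (s + 1) = (if 0 < j then (1 - \<alpha>) * x (p (j - 1)) else - \<alpha> * x (p j))"
      using s \<alpha> by (auto simp: X_def j_def)
    have \<delta>s: "\<delta> s = \<rho> - \<alpha> * (if j = M then real m + 2 else 2)"
      using s by (auto simp: \<delta>_def j_def n_def)
    show ?thesis
      unfolding distrib_left Xnext unfolding Xs Xprev \<delta>s using eq
      by (auto simp: algebra_simps split: if_splits)
  qed
  have Yeq: "\<delta> s * Y s = (1 - \<alpha>) * (Y (s - 1) + Y (s + 1))" if s: "1 \<le> s" "s \<le> n" for s
  proof -
    \<comment> \<open>The left tail is assumed shorter, so the even side of the extremal graph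
      continues beyond every index used and needs no fictitious value.\<close>
    have k2: "2 * s + 2 \<le> k" using s short by (simp add: n_def)
    have y_le: "y j = a j" if "j \<le> k" for j using that by (simp add: y_def)
    have SY: "(\<Sum>j\<in>{k<..k + m}. (1 - \<alpha>) * y j) = (1 - \<alpha>) * S"
      unfolding S_def sum_distrib_left using sum.reindex_bij_betw[OF \<beta>, of "\<lambda>w. (1 - \<alpha>) * x w"]
      by (simp add: y_def)
    have "\<rho> * a (2 * s) = (\<Sum>j\<in>parcs (bag_graph k m) `` {2 * s}. \<alpha> * a (2 * s) + (1 - \<alpha>) * y j)"
      using y_eigen[of "2 * s"] k2 by (simp add: y_def)
    also have "parcs (bag_graph k m) `` {2 * s} = {2 * s - 2, 2 * s + 2} \<union> (if s = 1 then {k<..k + m} else {})"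
      using k2 s by (subst Image_bag_graph) (auto simp: spine_iff)
    also have "(\<Sum>j\<in>\<dots>. \<alpha> * a (2 * s) + (1 - \<alpha>) * y j) =
      (\<alpha> * a (2 * s) + (1 - \<alpha>) * a (2 * s - 2)) + (\<alpha> * a (2 * s) + (1 - \<alpha>) * a (2 * s + 2)) +
      (if s = 1 then m * (\<alpha> * a (2 * s)) + (1 - \<alpha>) * S else 0)"
      using k2 s SY by (subst sum.union_disjoint) (auto simp: sum.distrib y_le)
    finally have eq: "\<rho> * a (2 * s) = \<dots>" .
    show ?thesis
    proof (cases "s = 1")
      case True
      then show ?thesis using eq by (simp add: \<delta>_def Y_def algebra_simps)
    next
      case False
      then have "2 * (s - 1) = 2 * s - 2" by simp
      then show ?thesis using eq False s by (simp add: \<delta>_def Y_def algebra_simps)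
    qed
  qed
  have "X 0 * Y 1 - X 1 * Y 0 = X n * Y (n + 1) - X (n + 1) * Y n"
    by (rule wronskian_const[where c = "1 - \<alpha>" and \<delta> = \<delta>]) (use \<alpha> Xeq Yeq in auto)
  \<comment> \<open>At the outer end \<open>X n\<close> and \<open>Y (n + 1)\<close> are positive,
    while the fictitious \<open>X (n + 1)\<close> is at most zero.\<close>
  also have "\<dots> > 0"
  proof -
    have x0: "x (p 0) > 0" using x_pos pin[of 0] by simp
    have "X n = x (p 0)" "X (n + 1) = - (\<alpha> / (1 - \<alpha>)) * x (p 0)" by (simp_all add: X_def n_def)
    moreover have "Y n \<ge> 0" "Y (n + 1) > 0"
      using a_nonneg a_pos[of "2 * (n + 1)"] short by (auto simp: Y_def n_def)
    then have "x (p 0) * Y (n + 1) > 0" "\<alpha> / (1 - \<alpha>) * x (p 0) * Y n \<ge> 0"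
      using \<alpha> x0 by simp_all
    ultimately show ?thesis by simp
  qed
  finally have W: "X 1 * Y 0 < X 0 * Y 1" by simp
  have Y1: "Y 1 = a 2" by (simp add: Y_def)
  \<comment> \<open>Both contain the same \<open>S\<close>, and \<open>a 0\<close> is the largest
    value on the path. With the Wronskian inequality this gives \<open>X 1 < Y 1\<close>.\<close>
  have "X 0 \<le> Y 0"
  proof -
    have "n \<in> \<tau> ` {..k}" using \<tau> Mk by (auto simp: bij_betw_def n_def)
    then obtain i where "i \<le> k" "n = \<tau> i" by auto
    then have "x (p n) = a i" by (simp add: a_def)
    also have "\<dots> \<le> a 0" by (intro antimonoD[OF antimono_a]) simp
    finally show ?thesis by (simp add: X_def Y_def)
  qed
  moreover have "0 \<le> Y 1" unfolding Y1 by (rule a_nonneg)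
  ultimately have "X 0 * Y 1 \<le> Y 0 * Y 1" by (rule mult_right_mono)
  with W have "Y 0 * X 1 < Y 0 * Y 1" by (simp add: mult.commute)
  moreover have "Y 0 > 0" using a_pos[of 0] S0 by (simp add: Y_def)
  ultimately have "X 1 < Y 1" by simp
  then have "X 1 < a 2" unfolding Y1 .
  moreover have "X 1 \<ge> a 2"
  proof -
    have "M \<in> \<tau> ` {..<3}" unfolding M by simp
    then obtain i where i: "i < 3" "M = \<tau> i" by auto
    have "a 2 \<le> a i" using i by (intro antimonoD[OF antimono_a]) simp
    also have "a i = X 1" using i k by (simp add: X_def n_def a_def)
    finally show ?thesis .
  qed
  ultimately show False by simp
qed

end

section \<open>From equality of spectral radii to an isomorphism\<close>

context geodesic
begin

lemma ex_outside_bij: "\<exists>\<beta>. bij_betw \<beta> {k<..k + m} outside"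
  using card_outside by (intro finite_same_card_bij) simp_all

lemma iso_bag_graph:
  assumes contact: "\<And>w j. w \<in> outside \<Longrightarrow> j \<le> k \<Longrightarrow>
      (w, p j) \<in> parcs G \<longleftrightarrow> k div 2 \<le> Suc j \<and> j \<le> Suc (k div 2)"
    and complete: "parcs G \<inter> outside \<times> outside = {(u, v). u \<in> outside \<and> v \<in> outside \<and> u \<noteq> v}"
  shows "\<exists>h. bij_betw h (pverts (bag_graph k m)) (pverts G) \<and>
    parcs G = map_prod h h ` parcs (bag_graph k m)"
proof -
  define c where "c = k div 2"
  have c: "1 \<le> c" "c \<le> k" using k by (auto simp: c_def)
  \<comment> \<open>Position on the geodesic of the extremal path vertex \<open>i\<close>: the
    centre 0 sits at \<open>k div 2\<close>, even vertices \<open>2 * t\<close> lie \<open>t\<close>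
    steps to its left and odd ones \<open>2 * t + 1\<close> lie \<open>t + 1\<close> steps to its
    right.\<close>
  define pos where "pos i = (if odd i then c + (i + 1) div 2 else c - i div 2)" for i
  have pos_odd: "pos (2 * t + 1) = c + t + 1" and pos_even: "pos (2 * t) = c - t" for t
    by (simp_all add: pos_def)
  have pos_le: "pos i \<le> k" if "i \<le> k" for i
    using that by (auto simp: pos_def c_def elim!: oddE)
  have "inj_on pos {..k}"
  proof (rule inj_onI)
    fix i j assume "i \<in> {..k}" "j \<in> {..k}" "pos i = pos j"
    then show "i = j"
      by (cases "even i"; cases "even j") (auto simp: pos_def c_def elim!: evenE oddE)
  qed
  moreover have "pos ` {..k} \<subseteq> {..k}" using pos_le by auto
  ultimately have "bij_betw pos {..k} {..k}"
    by (simp add: bij_betw_def endo_inj_surj)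
  then have ppos: "bij_betw (p \<circ> pos) {..k} (p ` {..k})"
    by (rule bij_betw_trans) (simp add: bij_betw_def p_inj)
  obtain \<beta> where \<beta>: "bij_betw \<beta> {k<..k + m} outside" using ex_outside_bij by blast
  define h where "h i = (if i \<le> k then p (pos i) else \<beta> i)" for i
  have h1: "bij_betw h {..k} (p ` {..k})"
    using ppos by (rule bij_betw_cong[THEN iffD1, rotated]) (simp add: h_def)
  have h2: "bij_betw h {k<..k + m} outside"
    using \<beta> by (rule bij_betw_cong[THEN iffD1, rotated]) (simp add: h_def)
  have "{..k + m} = {..k} \<union> {k<..k + m}" by auto
  then have h: "bij_betw h (pverts (bag_graph k m)) (pverts G)"
    using bij_betw_combine[OF h1 h2 V_split(2)] by (simp add: V_split(1))
  have him: "h ` {k<..k + m} = outside" and hinj: "inj_on h {k<..k + m}"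
    using h2 by (simp_all add: bij_betw_def)
  have hp: "h i = p (pos i)" if "i \<le> k" for i using that by (simp add: h_def)
  have "map_prod h h ` (spine k \<union> (spine k)\<inverse>) = path_arcs \<union> path_arcs\<inverse>"
  proof (intro equalityI subsetI)
    fix e assume "e \<in> map_prod h h ` (spine k \<union> (spine k)\<inverse>)"
    then obtain i j where ij: "(i, j) \<in> spine k" "e = (h i, h j) \<or> e = (h j, h i)" by auto
    have "\<exists>l<k. (h i = p l \<and> h j = p (Suc l)) \<or> (h j = p l \<and> h i = p (Suc l))"
    proof (cases "i = 0 \<and> j = 1")
      case True
      then show ?thesis using c k pos_even[of 0] pos_odd[of 0]
        by (intro exI[of _ c]) (auto simp: hp c_def)
    next
      case False
      then have j: "j = i + 2" "j \<le> k" using ij(1) k by (auto simp: spine_def)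
      show ?thesis
      proof (cases "even i")
        case True
        then obtain t where t: "i = 2 * t" by (elim evenE)
        then have "Suc t \<le> c" using j by (simp add: c_def)
        moreover have "h i = p (c - t)" "h j = p (c - Suc t)"
          using j t pos_even[of t] pos_even[of "Suc t"] by (simp_all add: hp)
        ultimately show ?thesis using c by (intro exI[of _ "c - Suc t"]) (auto simp: Suc_diff_Suc)
      next
        case False
        then obtain t where t: "i = 2 * t + 1" by (elim oddE)
        then have "c + t + 1 < k" using j by (simp add: c_def)
        moreover have "h i = p (c + t + 1)" "h j = p (Suc (c + t + 1))"
          using j t pos_odd[of t] pos_odd[of "Suc t"] by (simp_all add: hp)
        ultimately show ?thesis by (intro exI[of _ "c + t + 1"]) auto
      qed
    qed
    then show "e \<in> path_arcs \<union> path_arcs\<inverse>" using ij(2) by (auto simp: path_arcs_def)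
  next
    fix e assume "e \<in> path_arcs \<union> path_arcs\<inverse>"
    then obtain l where l: "l < k" "e = (p l, p (Suc l)) \<or> e = (p (Suc l), p l)"
      by (auto simp: path_arcs_def)
    have "\<exists>i j. (i, j) \<in> spine k \<and> ((h i = p l \<and> h j = p (Suc l)) \<or> (h j = p l \<and> h i = p (Suc l)))"
    proof -
      consider "l = c" | "l < c" | "c < l" by linarith
      then show ?thesis
      proof cases
        case 1
        then have "h 0 = p l" "h 1 = p (Suc l)"
          using k pos_even[of 0] pos_odd[of 0] by (auto simp: hp)
        then show ?thesis by (intro exI[of _ 0] exI[of _ 1]) (auto simp: spine_def)
      next
        case 2
        define t where "t = c - Suc l"
        have t: "l = c - Suc t" "Suc l = c - t" "2 * t + 2 \<le> k" using 2 by (auto simp: t_def c_def)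
        then have "h (2 * t) = p (Suc l)" "h (2 * t + 2) = p l"
          using pos_even[of t] pos_even[of "Suc t"] by (simp_all add: hp)
        moreover have "(2 * t, 2 * t + 2) \<in> spine k" using t by (auto simp: spine_def)
        ultimately show ?thesis by blast
      next
        case 3
        define t where "t = l - Suc c"
        have t: "l = c + t + 1" "2 * t + 3 \<le> k" using 3 l(1) by (auto simp: t_def c_def)
        then have "h (2 * t + 1) = p l" "h (2 * t + 3) = p (Suc l)"
          using pos_odd[of t] pos_odd[of "Suc t"] by (simp_all add: hp numeral_3_eq_3)
        moreover have "(2 * t + 1, 2 * t + 3) \<in> spine k"
          using t by (auto simp: spine_def intro!: image_eqI[of _ _ "2 * t + 1"])
        ultimately show ?thesis by blast
      qed
    qed
    then obtain i j where ij: "(i, j) \<in> spine k"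
      "(h i = p l \<and> h j = p (Suc l)) \<or> (h j = p l \<and> h i = p (Suc l))" by blast
    then have "e = map_prod h h (i, j) \<or> e = map_prod h h (j, i)" using l(2) by auto
    then show "e \<in> map_prod h h ` (spine k \<union> (spine k)\<inverse>)" using ij(1) by blast
  qed
  moreover have "h ` {..<3} = p ` {c - 1..c + 1}"
  proof -
    have "{..<3} = {0, 1, 2 :: nat}" by auto
    moreover have "{c - 1..c + 1} = {c, c + 1, c - 1}" using c by auto
    ultimately show ?thesis using k pos_even[of 0] pos_even[of 1] pos_odd[of 0] by (simp add: hp)
  qed
  moreover have WP: "parcs G \<inter> outside \<times> p ` {..k} = outside \<times> p ` {c - 1..c + 1}"
  proof -
    have "c + 1 \<le> k" using k by (simp add: c_def)
    then show ?thesis using contact by (auto simp: c_def[symmetric])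
  qed
  moreover have "parcs G \<inter> p ` {..k} \<times> outside = p ` {c - 1..c + 1} \<times> outside"
  proof -
    have "parcs G \<inter> p ` {..k} \<times> outside = (parcs G \<inter> outside \<times> p ` {..k})\<inverse>"
      using sym_arc by auto
    then show ?thesis by (simp add: WP converse_Times)
  qed
  moreover
  have "parcs G \<subseteq> (p ` {..k} \<union> outside) \<times> (p ` {..k} \<union> outside)"
    unfolding V_split(1)[symmetric] using in_arcsD1 in_arcsD2 by auto
  then have "parcs G = (parcs G \<inter> p ` {..k} \<times> p ` {..k}) \<union> (parcs G \<inter> outside \<times> outside) \<union>
      (parcs G \<inter> outside \<times> p ` {..k}) \<union> (parcs G \<inter> p ` {..k} \<times> outside)"
    by blast
  ultimately have G: "parcs G = (path_arcs \<union> path_arcs\<inverse>) \<union>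
      {(u, v). u \<in> outside \<and> v \<in> outside \<and> u \<noteq> v} \<union>
      outside \<times> h ` {..<3} \<union> h ` {..<3} \<times> outside"
    and spine: "map_prod h h ` (spine k \<union> (spine k)\<inverse>) = path_arcs \<union> path_arcs\<inverse>"
    by (simp_all only: parcs_on_path complete)
  have "map_prod h h ` parcs (bag_graph k m) = parcs G"
    unfolding bag_graph_def pair_pre_digraph.simps G him[symmetric] spine[symmetric]
      map_prod_off_diagonal[OF hinj, symmetric] image_Un[of _ "_ \<union> _"]
      map_prod_surj_on[OF refl refl] by (simp only: image_Un)
  with h show ?thesis by (intro exI[of _ h]) simp
qed

text \<open>The rearranged vector \<open>S.y\<close> is a unit trial vector for the extremal graph,
  so its form lies between the two spectral radii. If these agree, it attains the maximum and hence
  satisfies the eigenvalue equations.\<close>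

lemma rho_alpha_geodesic:
  assumes conn: "Digraph_Component.connected (with_proj G)" and \<alpha>: "0 \<le> \<alpha>" "\<alpha> < 1"
  shows "rho_alpha \<alpha> G \<le> rho_alpha \<alpha> (bag_graph k m)"
    and "rho_alpha \<alpha> G = rho_alpha \<alpha> (bag_graph k m) \<Longrightarrow> 1 \<le> m \<Longrightarrow>
      parcs G \<inter> outside \<times> outside = {(u, v). u \<in> outside \<and> v \<in> outside \<and> u \<noteq> v} \<and>
      (\<exists>M. M + 2 \<le> k \<and> k div 2 \<le> Suc M \<and>
        (\<forall>w\<in>outside. \<forall>j\<le>k. (w, p j) \<in> parcs G \<longleftrightarrow> M \<le> j \<and> j \<le> M + 2))"
proof -
  have ne: "pverts G \<noteq> {}" using p_in by auto
  have bag: "pair_graph (bag_graph k m)" "pverts (bag_graph k m) \<noteq> {}"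
    using pair_graph_bag_graph[OF k] by auto
  obtain x where x: "\<And>u. u \<in> pverts G \<Longrightarrow> x u > 0" "(\<Sum>u\<in>pverts G. (x u)\<^sup>2) = 1"
    "arc_form \<alpha> (parcs G) x = rho_alpha \<alpha> G"
    using rho_alpha_positive_vector[OF pair_graph ne \<alpha> conn] by blast
  obtain \<tau> where \<tau>: "bij_betw \<tau> {..k} {..k}"
    "\<And>i j. i \<le> j \<Longrightarrow> j \<le> k \<Longrightarrow> x (p (\<tau> j)) \<le> x (p (\<tau> i))"
    using ex_decreasing_arrangement[of k "\<lambda>j. x (p j)"] by blast
  obtain \<beta> where \<beta>: "bij_betw \<beta> {k<..k + m} outside" using ex_outside_bij by blast
  interpret S: sorted_geodesic G k m p \<alpha> x \<tau> \<beta>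
    by unfold_locales (use \<alpha> x(1) \<tau> \<beta> in auto)
  have y1: "(\<Sum>i\<in>pverts (bag_graph k m). (S.y i)\<^sup>2) = 1" using S.sum_y_squares x(2) by simp
  note bound = rho_alpha_bound[OF bag \<alpha>, of S.y, unfolded y1]
  show "rho_alpha \<alpha> G \<le> rho_alpha \<alpha> (bag_graph k m)"
    using S.arc_form_le bound x(3) by simp
  assume eq: "rho_alpha \<alpha> G = rho_alpha \<alpha> (bag_graph k m)" and m: "1 \<le> m"
  have form: "arc_form \<alpha> (parcs G) x = arc_form \<alpha> (parcs (bag_graph k m)) S.y"
    using S.arc_form_le bound x(3) eq by simp
  interpret X: extremal_geodesic G k m p \<alpha> x \<tau> \<beta> "rho_alpha \<alpha> G"
  proof unfold_locales
    show "(\<Sum>v\<in>parcs G `` {u}. \<alpha> * x u + (1 - \<alpha>) * x v) = rho_alpha \<alpha> G * x u"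
      if "u \<in> pverts G" for u
      by (rule rho_alpha_eigenvector[OF pair_graph ne \<alpha> _ that]) (simp add: x)
    show "(\<Sum>j\<in>parcs (bag_graph k m) `` {i}. \<alpha> * S.y i + (1 - \<alpha>) * S.y j) = rho_alpha \<alpha> G * S.y i"
      if "i \<le> k + m" for i
      unfolding eq using that y1 form x(3) eq
      by (intro rho_alpha_eigenvector[OF bag \<alpha>]) simp_all
  qed (use form m in auto)
  obtain M where M: "M + 2 \<le> k" "\<tau> ` {..<3} = {M..M + 2}" using X.ex_window by blast
  then show "parcs G \<inter> outside \<times> outside = {(u, v). u \<in> outside \<and> v \<in> outside \<and> u \<noteq> v} \<and>
      (\<exists>M. M + 2 \<le> k \<and> k div 2 \<le> Suc M \<and>
        (\<forall>w\<in>outside. \<forall>j\<le>k. (w, p j) \<in> parcs G \<longleftrightarrow> M \<le> j \<and> j \<le> M + 2))"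
    using X.outside_complete X.centre_ge X.outside_neighbours
    by (auto simp: S.outside_pairs_def intro!: exI[of _ M])
qed

text \<open>If \<open>m = 0\<close>, no vertex lies off the geodesic and the contact conditions are
  vacuous. Otherwise the lower bound on the left tail is applied in both directions.\<close>

lemma rho_alpha_geodesic_eq_imp_iso:
  assumes conn: "Digraph_Component.connected (with_proj G)" and \<alpha>: "0 \<le> \<alpha>" "\<alpha> < 1"
    and eq: "rho_alpha \<alpha> G = rho_alpha \<alpha> (bag_graph k m)"
  shows "\<exists>h. bij_betw h (pverts (bag_graph k m)) (pverts G) \<and>
    parcs G = map_prod h h ` parcs (bag_graph k m)"
proof (cases "m = 0")
  case True
  then have "outside = {}" using card_outside by simp
  then show ?thesis by (intro iso_bag_graph) auto
next
  case False
  then have m: "1 \<le> m" by simp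
  interpret R: geodesic G k m "\<lambda>j. p (k - j)" by (rule reversed)
  have "(\<lambda>j. p (k - j)) ` {..k} = p ` {..k}"
  proof (intro equalityI subsetI)
    fix v assume "v \<in> p ` {..k}"
    then obtain i where "v = p i" "i \<le> k" by auto
    then show "v \<in> (\<lambda>j. p (k - j)) ` {..k}" by (intro image_eqI[of _ _ "k - i"]) auto
  qed auto
  then have out: "R.outside = outside" by (simp add: R.outside_def outside_def)
  obtain M where M: "M + 2 \<le> k" "k div 2 \<le> Suc M"
    "\<And>w j. w \<in> outside \<Longrightarrow> j \<le> k \<Longrightarrow> (w, p j) \<in> parcs G \<longleftrightarrow> M \<le> j \<and> j \<le> M + 2"
    and complete: "parcs G \<inter> outside \<times> outside = {(u, v). u \<in> outside \<and> v \<in> outside \<and> u \<noteq> v}"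
    using rho_alpha_geodesic(2)[OF conn \<alpha> eq m] by blast
  obtain M' where M': "M' + 2 \<le> k" "k div 2 \<le> Suc M'"
    "\<And>w j. w \<in> outside \<Longrightarrow> j \<le> k \<Longrightarrow> (w, p (k - j)) \<in> parcs G \<longleftrightarrow> M' \<le> j \<and> j \<le> M' + 2"
    using R.rho_alpha_geodesic(2)[OF conn \<alpha> eq m] unfolding out by blast
  have "outside \<noteq> {}" using card_outside m by auto
  then obtain w where w: "w \<in> outside" by blast
  have "(w, p (k - M')) \<in> parcs G" "(w, p (k - (M' + 2))) \<in> parcs G"
    using M'(3)[OF w, of M'] M'(3)[OF w, of "M' + 2"] M'(1) by simp_all
  then have "k - M' \<le> M + 2" "M \<le> k - (M' + 2)"
    using M(3)[OF w, of "k - M'"] M(3)[OF w, of "k - (M' + 2)"] by simp_all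
  \<comment> \<open>\<open>M\<close> and \<open>M'\<close> describe the same window counted from
    opposite ends. \<open>Suc M\<close> and \<open>Suc M'\<close> sum to \<open>k\<close> and are
    both at least \<open>k div 2\<close>, so one of them equals it, and the geodesic is read in that
    direction. For odd \<open>k\<close> both directions can be needed.\<close>
  then have "M + M' + 2 = k" using M'(1) by linarith
  then consider "Suc M = k div 2" | "Suc M' = k div 2" using M(2) M'(2) by linarith
  then show ?thesis
  proof cases
    case 1
    then show ?thesis using complete M(3) by (intro iso_bag_graph) auto
  next
    case 2
    then show ?thesis using complete M'(3) by (intro R.iso_bag_graph) (auto simp: out)
  qed
qed

end

section \<open>Geodesics in graphs of large diameter\<close>

lemma (in pair_graph) relpow_awalk:
  "(u, v) \<in> parcs G ^^ n \<Longrightarrow> u \<in> pverts G \<Longrightarrow> \<exists>q. awalk u q v \<and> length q = n"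
proof (induction n arbitrary: v)
  case 0
  then show ?case by (intro exI[of _ "[]"]) (simp add: awalk_Nil_iff)
next
  case (Suc n)
  then obtain w where w: "(u, w) \<in> parcs G ^^ n" "(w, v) \<in> parcs G" by auto
  then obtain q where q: "awalk u q w" "length q = n" using Suc by blast
  have "awalk w [(w, v)] v" using w(2) arc_implies_awalk[of "(w, v)"] by simp
  with q(1) have "awalk u (q @ [(w, v)]) v" by (rule awalk_appendI)
  with q(2) show ?case by (intro exI[of _ "q @ [(w, v)]"]) simp
qed

lemma (in pair_graph) awalk_cost_one: "awalk_cost (\<lambda>_. 1) q = length q"
  by (induction q) simp_all

lemma (in pair_graph) graph_dist_le_relpow:
  assumes "(u, v) \<in> parcs G ^^ n" "u \<in> pverts G"
  shows "graph_dist G u v \<le> ereal n"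
proof -
  obtain q where "awalk u q v" "length q = n" using relpow_awalk[OF assms] by blast
  then show ?thesis
    using min_cost_le_walk_cost[of u q v "\<lambda>_. 1"] by (simp add: graph_dist_def awalk_cost_one)
qed

text \<open>If any two vertices were joined in fewer than \<open>k\<close> steps, the diameter would
  be at most \<open>k - 1\<close>. So some pair has a shortest walk of length
  \<open>L \<ge> k\<close>, and its first \<open>k + 1\<close> vertices serve.\<close>

lemma (in pair_graph) ex_geodesic:
  assumes conn: "Digraph_Component.connected (with_proj G)" and k: "2 \<le> k"
    and diam: "diam G \<ge> ereal (real k)"
  shows "\<exists>m p. geodesic G k m p"
proof -
  have "\<exists>u\<in>pverts G. \<exists>v\<in>pverts G. \<forall>n<k. (u, v) \<notin> parcs G ^^ n"
  proof (rule ccontr)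
    assume "\<not> ?thesis"
    then have close: "\<exists>n<k. (u, v) \<in> parcs G ^^ n" if "u \<in> pverts G" "v \<in> pverts G" for u v
      using that by blast
    have "graph_dist G u v \<le> ereal (real (k - 1))" if uv: "u \<in> pverts G" "v \<in> pverts G" for u v
    proof -
      obtain n where n: "n < k" "(u, v) \<in> parcs G ^^ n" using close[OF uv] by blast
      have "graph_dist G u v \<le> ereal n" by (rule graph_dist_le_relpow[OF n(2) uv(1)])
      also have "ereal n \<le> ereal (real (k - 1))" using n(1) by simp
      finally show ?thesis .
    qed
    then have "diam G \<le> ereal (real (k - 1))"
      unfolding diam_def by (intro SUP_least)
    with diam have "ereal (real k) \<le> ereal (real (k - 1))" by (rule order_trans)
    then show False using k by simp
  qed
  then obtain u v where u: "u \<in> pverts G" and v: "v \<in> pverts G"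
    and far: "\<And>n. n < k \<Longrightarrow> (u, v) \<notin> parcs G ^^ n" by blast
  have "strongly_connected (with_proj G)"
    using pair_sym_arcs conn by (intro symmetric_connected_imp_strongly_connected)
  then have "(u, v) \<in> (parcs G)\<^sup>*"
    using u v rtrancl_on_sub_rtrancl[of "pverts G" "parcs G"]
    by (auto simp: strongly_connected_def reachable_def)
  then obtain n where n: "(u, v) \<in> parcs G ^^ n" using rtrancl_imp_relpow by blast
  define L where "L = (LEAST n. (u, v) \<in> parcs G ^^ n)"
  have L: "(u, v) \<in> parcs G ^^ L" unfolding L_def using n by (rule LeastI)
  have least: "L \<le> n" if "(u, v) \<in> parcs G ^^ n" for n unfolding L_def using that by (rule Least_le)
  have kL: "k \<le> L" using far[of L] L by (meson not_le)
  obtain p where p: "p 0 = u" "p L = v" "\<And>i. i < L \<Longrightarrow> (p i, p (Suc i)) \<in> parcs G"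
    using L unfolding relpow_fun_conv by blast
  have pre: "(u, p i) \<in> parcs G ^^ i" if "i \<le> L" for i
    using that p by (intro relpow_fun_conv[THEN iffD2] exI[of _ p]) auto
  have post: "(p i, v) \<in> parcs G ^^ (L - i)" if "i \<le> L" for i
    using that p by (intro relpow_fun_conv[THEN iffD2] exI[of _ "\<lambda>j. p (i + j)"]) auto
  \<comment> \<open>A quicker way to \<open>p i\<close>, continued by the rest of the walk, would
    reach \<open>v\<close> in fewer than \<open>L\<close> steps. Injectivity, \<open>chord\<close>
    and \<open>detour\<close> are all instances of this.\<close>
  have dist: "i \<le> n" if "i \<le> L" "(u, p i) \<in> parcs G ^^ n" for i n
  proof -
    have "(u, v) \<in> parcs G ^^ (n + (L - i))"
      using that(2) post[OF that(1)] unfolding relpow_add by blast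
    from least[OF this] that(1) show ?thesis by simp
  qed
  have inV: "p i \<in> pverts G" if "i \<le> k" for i
  proof (cases "i < L")
    case True
    then show ?thesis using p(3) in_arcsD1 by blast
  next
    case False
    then have "i = L" using that kL by simp
    then show ?thesis using p(2) v by simp
  qed
  have inj: "inj_on p {..k}"
  proof (rule inj_onI)
    fix i j assume ij: "i \<in> {..k}" "j \<in> {..k}" "p i = p j"
    then have le: "i \<le> L" "j \<le> L" using kL by simp_all
    have "i \<le> j" by (rule dist[OF le(1)]) (use pre[OF le(2)] ij(3) in simp)
    moreover have "j \<le> i" by (rule dist[OF le(2)]) (use pre[OF le(1)] ij(3) in simp)
    ultimately show "i = j" by simp
  qed
  have "Suc k \<le> card (pverts G)"
    using card_mono[OF pair_finite_verts, of "p ` {..k}"] inV inj by (auto simp: card_image)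
  then obtain m where m: "card (pverts G) = Suc (k + m)" by (metis add_Suc le_Suc_ex)
  have "geodesic G k m p"
  proof unfold_locales
    show "(p j, p (Suc j)) \<in> parcs G" if "j < k" for j using p(3) that kL by simp
    show "j \<le> Suc i" if "i \<le> k" "j \<le> k" "(p i, p j) \<in> parcs G" for i j
      using dist[of j "Suc i"] pre[of i] that kL by auto
    show "j \<le> i + 2" if "i \<le> k" "j \<le> k" "(p i, w) \<in> parcs G" "(w, p j) \<in> parcs G" for i j w
    proof -
      have "(u, p j) \<in> parcs G ^^ Suc (Suc i)" using pre[of i] that kL by auto
      with dist[of j "Suc (Suc i)"] that kL show ?thesis by simp
    qed
  qed (use k inj inV m in auto)
  then show ?thesis by blast
qed

section \<open>Complete graphs and the case k = 1\<close>

lemma complete_graph_simps [simp]: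
  "pverts (complete_graph n) = {..<n}"
  "parcs (complete_graph n) = {(u, v). u \<in> {..<n} \<and> v \<in> {..<n} \<and> u \<noteq> v}"
  by (auto simp: complete_graph_def)

text \<open>Serves to transfer the axioms of a simple graph from \<open>bag_graph\<close> to
  \<open>B_graph\<close>.\<close>

lemma pair_graph_image:
  assumes G: "pair_graph G" and h: "bij_betw h (pverts G) (pverts H)" "parcs H = map_prod h h ` parcs G"
  shows "pair_graph H"
proof -
  interpret pair_graph G by (rule G)
  have inj: "inj_on h (pverts G)" and V: "pverts H = h ` pverts G"
    using h(1) by (auto simp: bij_betw_def)
  show ?thesis
  proof
    fix e assume "e \<in> parcs H"
    then obtain u v where e: "e = (h u, h v)" "(u, v) \<in> parcs G" unfolding h(2) by auto
    then have uv: "u \<in> pverts G" "v \<in> pverts G" "u \<noteq> v"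
      using in_arcsD1 in_arcsD2 pair_no_loops[of "(u, v)"] by auto
    then show "fst e \<in> pverts H" "snd e \<in> pverts H" by (simp_all add: e V)
    show "fst e \<noteq> snd e" using inj_onD[OF inj, of u v] uv by (auto simp: e)
  next
    show "finite (pverts H)" unfolding V using pair_finite_verts by simp
    show "finite (parcs H)" unfolding h(2) using pair_finite_arcs by simp
    have "(h v, h u) \<in> parcs H" if "(u, v) \<in> parcs G" for u v
    proof -
      have "(v, u) \<in> parcs G" using that arcs_symmetric by blast
      then show ?thesis unfolding h(2) by (metis image_eqI map_prod_simp)
    qed
    then show "symmetric (with_proj H)"
      unfolding symmetric_def sym_def by (auto simp: h(2))
  qed
qed

lemma pair_graph_complete_graph: "pair_graph (complete_graph n)"
proof -
  have "graph (with_proj (complete_graph n))"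
    using complete_digraph_complete_graph[of n] by (simp add: complete_digraph_def)
  then show ?thesis by (rule pair_graphI_graph)
qed

lemma (in pair_graph) complete_graph_iso:
  assumes "parcs G = {(u, v). u \<in> pverts G \<and> v \<in> pverts G \<and> u \<noteq> v}"
  shows "digraph_iso (with_proj G) (with_proj (complete_graph (card (pverts G))))"
proof -
  let ?K = "complete_graph (card (pverts G))"
  obtain h where h: "bij_betw h {..<card (pverts G)} (pverts G)"
    using ex_bij_betw_nat_finite[OF pair_finite_verts] by (auto simp: atLeast0LessThan)
  then have "parcs G = map_prod h h ` parcs ?K"
    using map_prod_off_diagonal[of h "{..<card (pverts G)}"] assms
    by (simp add: bij_betw_def)
  moreover have "bij_betw h (pverts ?K) (pverts G)" using h by simp
  moreover have wf: "pair_wf_digraph ?K"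
    using pair_graph_complete_graph by (simp add: pair_graph_def pair_digraph_def pair_fin_digraph_def)
  ultimately have "digraph_iso (with_proj ?K) (with_proj G)"
    unfolding digraph_iso_with_proj_iff[OF wf pair_wf_digraph] by blast
  from digraph_iso_swap[OF _ this] show ?thesis using wf by (simp add: wf_digraph_wp_iff)
qed

text \<open>With a positive maximiser for \<open>G\<close>, every missing arc would add a positive
  amount to the form.\<close>

lemma (in pair_graph) rho_alpha_complete:
  assumes conn: "Digraph_Component.connected (with_proj G)" and \<alpha>: "0 \<le> \<alpha>" "\<alpha> < 1"
    and ne: "pverts G \<noteq> {}"
  shows "rho_alpha \<alpha> G \<le> rho_alpha \<alpha> (complete_graph (card (pverts G)))"
    and "rho_alpha \<alpha> G = rho_alpha \<alpha> (complete_graph (card (pverts G))) \<Longrightarrow>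
      parcs G = {(u, v). u \<in> pverts G \<and> v \<in> pverts G \<and> u \<noteq> v}"
proof -
  let ?K = "complete_graph (card (pverts G))"
  let ?D = "{(u, v). u \<in> pverts G \<and> v \<in> pverts G \<and> u \<noteq> v}"
  have K: "pair_graph ?K" "pverts ?K \<noteq> {}" "pverts ?K = {..<card (pverts G)}"
    "parcs ?K = {(u, v). u \<in> {..<card (pverts G)} \<and> v \<in> {..<card (pverts G)} \<and> u \<noteq> v}"
    using pair_graph_complete_graph ne pair_finite_verts
    by (simp_all add: lessThan_empty_iff bot_nat_def card_eq_0_iff)
  obtain x where x: "\<And>u. u \<in> pverts G \<Longrightarrow> x u > 0" "(\<Sum>u\<in>pverts G. (x u)\<^sup>2) = 1"
    "arc_form \<alpha> (parcs G) x = rho_alpha \<alpha> G"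
    using rho_alpha_positive_vector[OF pair_graph ne \<alpha> conn] by blast
  obtain h where h: "bij_betw h {..<card (pverts G)} (pverts G)"
    using ex_bij_betw_nat_finite[OF pair_finite_verts] by (auto simp: atLeast0LessThan)
  then have inj: "inj_on h {..<card (pverts G)}" and im: "h ` {..<card (pverts G)} = pverts G"
    by (simp_all add: bij_betw_def)
  have "?D = map_prod h h ` parcs ?K"
    unfolding K(4) map_prod_off_diagonal[OF inj] im ..
  moreover have "parcs ?K \<subseteq> {..<card (pverts G)} \<times> {..<card (pverts G)}" unfolding K(4) by auto
  ultimately have D: "arc_form \<alpha> ?D x = arc_form \<alpha> (parcs ?K) (x \<circ> h)"
    by (simp only: arc_form_reindex[OF inj])
  have "(\<Sum>i\<in>pverts ?K. ((x \<circ> h) i)\<^sup>2) = 1"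
    using sum.reindex_bij_betw[OF h, of "\<lambda>u. (x u)\<^sup>2"] x(2) by (simp add: K(3))
  with rho_alpha_bound[OF K(1,2) \<alpha>, of "x \<circ> h"] D
  have le: "arc_form \<alpha> ?D x \<le> rho_alpha \<alpha> ?K" by simp
  have fin: "finite ?D"
    by (rule finite_subset[of _ "pverts G \<times> pverts G"]) (use pair_finite_verts in auto)
  have sub: "parcs G \<subseteq> ?D"
    using in_arcsD1 in_arcsD2 pair_no_loops by fastforce
  have pos: "x u > 0 \<and> x v > 0" if "(u, v) \<in> ?D" for u v using that x(1) by simp
  have G_le: "arc_form \<alpha> (parcs G) x \<le> arc_form \<alpha> ?D x"
    by (rule arc_form_mono(1)[OF fin sub _ \<alpha>]) (rule pos)
  with le x(3) show "rho_alpha \<alpha> G \<le> rho_alpha \<alpha> ?K" by simp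
  assume "rho_alpha \<alpha> G = rho_alpha \<alpha> ?K"
  with G_le le x(3) have eq: "arc_form \<alpha> (parcs G) x = arc_form \<alpha> ?D x" by simp
  show "parcs G = ?D"
  proof (rule arc_form_mono(2)[OF fin sub _ \<alpha>])
    show "x u > 0 \<and> x v > 0" if "(u, v) \<in> ?D" for u v using that by (rule pos)
    show "arc_form \<alpha> (parcs G) x = arc_form \<alpha> ?D x" by (rule eq)
  qed
qed

lemma (in pair_graph) diam_le_one_imp_complete:
  assumes "diam G \<le> 1"
  shows "parcs G = {(u, v). u \<in> pverts G \<and> v \<in> pverts G \<and> u \<noteq> v}"
proof -
  have "(u, v) \<in> parcs G" if uv: "u \<in> pverts G" "v \<in> pverts G" "u \<noteq> v" for u v
  proof (rule ccontr)
    assume non: "(u, v) \<notin> parcs G"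
    \<comment> \<open>Between distinct non-adjacent vertices there is no walk with fewer than two
      arcs.\<close>
    have "ereal 2 \<le> graph_dist G u v"
      unfolding graph_dist_def \<mu>_def
    proof (rule INF_greatest)
      fix q assume "q \<in> {q. awalk u q v}"
      then have q: "awalk u q v" by simp
      have "2 \<le> length q"
      proof (cases q)
        case Nil
        then show ?thesis using q uv by (simp add: awalk_Nil_iff)
      next
        case (Cons e q')
        then show ?thesis using q non
          by (cases q') (auto simp: awalk_Cons_iff awalk_Nil_iff)
      qed
      then show "ereal 2 \<le> ereal (awalk_cost (\<lambda>_. 1) q)" by (simp add: awalk_cost_one)
    qed
    also have "graph_dist G u v \<le> diam G"
      unfolding diam_def using uv by (intro SUP_upper2[of u] SUP_upper2[of v] order_refl)
    also have "diam G \<le> ereal 1" using assms by (simp add: one_ereal_def)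
    finally show False by simp
  qed
  moreover have "u \<in> pverts G \<and> v \<in> pverts G \<and> u \<noteq> v" if "(u, v) \<in> parcs G" for u v
    using that in_arcsD1 in_arcsD2 pair_no_loops by fastforce
  ultimately show ?thesis by (intro equalityI subrelI) (unfold mem_Collect_eq case_prod_conv, blast+)
qed

text \<open>For k = 1 the equality of radii is tied to diameter exactly one: the path on three
  vertices has diameter two and a smaller radius than the triangle. Connectedness excludes graphs of
  infinite diameter such as a triangle with an isolated vertex, which for k = 3 and \<alpha> = 0 has
  a larger radius than the path on four vertices.\<close>

theorem theorem3:
  fixes \<alpha> :: real and G :: "'a pair_pre_digraph" and n k :: nat
  assumes "0 \<le> \<alpha>" and "\<alpha> < 1"
    and "pair_graph G" and "Digraph_Component.connected (with_proj G)"
    and "card (pverts G) = n"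
    and "diam G \<ge> ereal (real k)"
  shows "(k = 1 \<longrightarrow>
           (diam G = ereal (real k) \<longrightarrow> rho_alpha \<alpha> G = rho_alpha \<alpha> (complete_graph n)) \<and>
           rho_alpha \<alpha> G \<le> rho_alpha \<alpha> (complete_graph n) \<and>
           (rho_alpha \<alpha> G = rho_alpha \<alpha> (complete_graph n) \<longleftrightarrow>
              digraph_iso (with_proj G) (with_proj (complete_graph n)))) \<and>
         (k \<ge> 2 \<longrightarrow>
           rho_alpha \<alpha> G \<le> rho_alpha \<alpha> (B_graph (n - k + 2) (k div 2) ((k + 1) div 2)) \<and>
           (rho_alpha \<alpha> G = rho_alpha \<alpha> (B_graph (n - k + 2) (k div 2) ((k + 1) div 2)) \<longleftrightarrow>
              digraph_iso (with_proj G)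
                (with_proj (B_graph (n - k + 2) (k div 2) ((k + 1) div 2)))))"
proof -
  interpret pair_graph G by fact
  note \<alpha> = assms(1,2) and conn = assms(4)
  have ne: "pverts G \<noteq> {}" using conn by (auto simp: connected_conv)
  let ?K = "complete_graph n" and ?B = "B_graph (n - k + 2) (k div 2) ((k + 1) div 2)"
  have K: "pair_graph ?K" "pverts ?K \<noteq> {}"
    using pair_graph_complete_graph ne pair_finite_verts
    by (simp_all add: assms(5)[symmetric] lessThan_empty_iff bot_nat_def card_eq_0_iff)
  note complete = rho_alpha_complete[OF conn \<alpha> ne, unfolded assms(5)]
    and iso_K = complete_graph_iso[unfolded assms(5)]
  have one: "(rho_alpha \<alpha> G = rho_alpha \<alpha> ?K) = digraph_iso (with_proj G) (with_proj ?K)"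
  proof
    assume "rho_alpha \<alpha> G = rho_alpha \<alpha> ?K"
    then show "digraph_iso (with_proj G) (with_proj ?K)" by (intro iso_K complete(2))
  qed (rule rho_alpha_iso[OF pair_graph ne K \<alpha>])
  have diam1: "rho_alpha \<alpha> G = rho_alpha \<alpha> ?K" if "diam G = ereal (real 1)"
  proof -
    have "diam G \<le> 1" using that by (simp add: one_ereal_def)
    then have "digraph_iso (with_proj G) (with_proj ?K)"
      by (intro iso_K diam_le_one_imp_complete)
    then show ?thesis using one by simp
  qed
  have two: "rho_alpha \<alpha> G \<le> rho_alpha \<alpha> ?B \<and>
      ((rho_alpha \<alpha> G = rho_alpha \<alpha> ?B) = digraph_iso (with_proj G) (with_proj ?B))" if k: "k \<ge> 2"
  proof -
    obtain m p where "geodesic G k m p" using ex_geodesic[OF conn k assms(6)] by blast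
    then interpret P: geodesic G k m p .
    let ?T = "bag_graph k m"
    \<comment> \<open>The clique consists of the \<open>m\<close> vertices off the geodesic and
      three on it.\<close>
    have p: "n - k + 2 = m + 3" using P.card_V assms(5) by simp
    note h = bag_graph_iso_B_graph[OF k, of m, folded p]
    have T: "pair_graph ?T" "pverts ?T \<noteq> {}" using pair_graph_bag_graph[OF k] by auto
    have wfT: "pair_wf_digraph ?T"
      using T(1) by (simp add: pair_graph_def pair_digraph_def pair_fin_digraph_def)
    have B: "pair_graph ?B" "pverts ?B \<noteq> {}"
      using pair_graph_image[OF T(1), of "bag_relabel k m" ?B] h by (auto simp: bij_betw_def)
    have wfB: "pair_wf_digraph ?B"
      using B(1) by (simp add: pair_graph_def pair_digraph_def pair_fin_digraph_def)
    have TB: "digraph_iso (with_proj ?T) (with_proj ?B)"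
      unfolding digraph_iso_with_proj_iff[OF wfT wfB]
      using h by (intro exI[of _ "bag_relabel k m"]) simp
    have rho: "rho_alpha \<alpha> ?T = rho_alpha \<alpha> ?B" by (rule rho_alpha_iso[OF T B \<alpha> TB])
    show ?thesis
    proof (intro conjI iffI)
      show "rho_alpha \<alpha> G \<le> rho_alpha \<alpha> ?B"
        using P.rho_alpha_geodesic(1)[OF conn \<alpha>] by (simp only: rho)
      show "rho_alpha \<alpha> G = rho_alpha \<alpha> ?B" if "digraph_iso (with_proj G) (with_proj ?B)"
        by (rule rho_alpha_iso[OF pair_graph ne B \<alpha> that])
      assume "rho_alpha \<alpha> G = rho_alpha \<alpha> ?B"
      then have "rho_alpha \<alpha> G = rho_alpha \<alpha> ?T" by (simp only: rho)
      then have "digraph_iso (with_proj ?T) (with_proj G)"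
        unfolding digraph_iso_with_proj_iff[OF wfT pair_wf_digraph]
        by (rule P.rho_alpha_geodesic_eq_imp_iso[OF conn \<alpha>])
      from digraph_iso_swap[OF _ this] have "digraph_iso (with_proj G) (with_proj ?T)"
        using wfT by (simp add: wf_digraph_wp_iff)
      then show "digraph_iso (with_proj G) (with_proj ?B)" using TB by (rule digraph_iso_trans)
    qed
  qed
  show ?thesis
  proof (intro conjI impI)
    show "rho_alpha \<alpha> G = rho_alpha \<alpha> ?K" if "k = 1" "diam G = ereal (real k)"
      using diam1 that by simp
    show "rho_alpha \<alpha> G \<le> rho_alpha \<alpha> ?K" by (rule complete(1))
    show "(rho_alpha \<alpha> G = rho_alpha \<alpha> ?K) = digraph_iso (with_proj G) (with_proj ?K)" by (rule one)
    show "rho_alpha \<alpha> G \<le> rho_alpha \<alpha> ?B" if "2 \<le> k" using two[OF that] by (rule conjunct1)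
    show "(rho_alpha \<alpha> G = rho_alpha \<alpha> ?B) = digraph_iso (with_proj G) (with_proj ?B)" if "2 \<le> k"
      using two[OF that] by (rule conjunct2)
  qed
qed

end
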